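(* Let $\alpha\in(0,2]$, let $\xi=(\xi_1,\dots,\xi_d)$ be an $S\alpha S$ random vector in $\mathbb{R}^d$ with associated star body $F$, and let $\lambda_1,\dots,\lambda_d$ be positive numbers with $\lambda=\sum_{i=1}^d\lambda_i<\alpha$. Then $$\mathbf{E}\big(|\xi_1|^{\lambda_1}\cdots|\xi_d|^{\lambda_d}\big)=2^{\lambda-d}\,\frac{(-1)^d}{\pi^{d/2}}\,\Gamma\Big(1-\frac{\lambda}{\alpha}\Big)\prod_{i=1}^d\frac{\lambda_i\Gamma(\frac{\lambda_i+1}{2})}{\Gamma(1-\frac{\lambda_i}{2})}\int_{\mathbb{R}^d}|u_1|^{-\lambda_1-1}\cdots|u_d|^{-\lambda_d-1}\,(\Delta_1\cdots\Delta_d 1_F(u))\,du.$$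
   Context: A random vector $\xi\in\mathbb{R}^d$ is symmetric $\alpha$-stable ($S\alpha S$), $\alpha\in(0,2]$, if $\xi$ has the same distribution as $-\xi$ and $a^{1/\alpha}\xi'+b^{1/\alpha}\xi''$ has the same distribution as $(a+b)^{1/\alpha}\xi$ for all $a,b>0$, where $\xi',\xi''$ are independent copies of $\xi$. Its characteristic function can be written as $\mathbf{E}e^{i\langle\xi,u\rangle}=e^{-\|u\|_F^\alpha}$ with $\|u\|_F^\alpha=\int_{\mathbb{S}^{d-1}}|\langle u,z\rangle|^\alpha\sigma(dz)$ for a symmetric finite measure $\sigma$ (the spectral measure) on the Euclidean unit sphere $\mathbb{S}^{d-1}$; the set $F=\{u:\|u\|_F\le1\}$ is the associated star body of $\xi$, and $1_F$ is its indicator function. For a function $g$ on $\mathbb{R}^d$ and $j=1,\dots,d$, $\Delta_jg(x)=g(x)-g(x|_j)$, where $x|_j$ is $x$ with its $j$th coordinate replaced by zero. The function $\Delta_1\cdots\Delta_d1_F(u)$ vanishes in a neighbourhood of the origin.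
   Formalization: The integral over R^d may fail to exist as a Lebesgue integral when λ≥1 (e.g. correlated Gaussian, d=2, λ_1≥1); it is taken as a principal value over {|u_i|>ε‖u‖ for all i}, ε→0, and is the Lebesgue integral whenever that exists, in particular when λ<1. *)

theory Defs
  imports "HOL-Probability.Probability"
begin

text \<open>
  The independent copies are realised as the two coordinates of the product of the law of
  \<open>\<xi>\<close> with itself.
\<close>

definition symmetric_stable :: "'a measure \<Rightarrow> real \<Rightarrow> ('a \<Rightarrow> real ^ 'n) \<Rightarrow> bool" where
  "symmetric_stable M \<alpha> \<xi> \<longleftrightarrow>
     0 < \<alpha> \<and> \<alpha> \<le> 2 \<and> \<xi> \<in> borel_measurable M \<and>
     distr M borel (\<lambda>\<omega>. - \<xi> \<omega>) = distr M borel \<xi> \<and>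
     (\<forall>a>0. \<forall>b>0.
        distr (distr M borel \<xi> \<Otimes>\<^sub>M distr M borel \<xi>) borel
          (\<lambda>(x, y). (a powr (1/\<alpha>)) *\<^sub>R x + (b powr (1/\<alpha>)) *\<^sub>R y) =
        distr M borel (\<lambda>\<omega>. ((a + b) powr (1/\<alpha>)) *\<^sub>R \<xi> \<omega>))"

text \<open>This is the gauge \<open>u \<mapsto> \<parallel>u\<parallel>\<^sub>F\<close> determined by \<open>\<sigma>\<close>.\<close>

definition stable_gauge :: "real \<Rightarrow> (real ^ 'n) measure \<Rightarrow> real ^ 'n \<Rightarrow> real" where
  "stable_gauge \<alpha> \<sigma> u = (LINT z|\<sigma>. \<bar>u \<bullet> z\<bar> powr \<alpha>) powr (1/\<alpha>)"

text \<open>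
  A measure on the unit sphere is represented as a Borel measure on the whole space that is
  concentrated on the sphere.
\<close>

definition spectral_measure ::
    "'a measure \<Rightarrow> real \<Rightarrow> ('a \<Rightarrow> real ^ 'n) \<Rightarrow> (real ^ 'n) measure \<Rightarrow> bool" where
  "spectral_measure M \<alpha> \<xi> \<sigma> \<longleftrightarrow>
     sets \<sigma> = sets borel \<and> finite_measure \<sigma> \<and> emeasure \<sigma> (- sphere 0 1) = 0 \<and>
     distr \<sigma> borel uminus = \<sigma> \<and>
     (\<forall>u. (LINT \<omega>|M. exp (\<i> * complex_of_real (\<xi> \<omega> \<bullet> u))) =
          complex_of_real (exp (- (stable_gauge \<alpha> \<sigma> u powr \<alpha>))))"

text \<open>
  For \<open>\<alpha> = 2\<close> the measure \<open>\<sigma>\<close> is not unique, but the characteristic function always determines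
  the gauge, so there is at most one \<open>F\<close>.
\<close>

definition associated_star_body ::
    "'a measure \<Rightarrow> real \<Rightarrow> ('a \<Rightarrow> real ^ 'n) \<Rightarrow> (real ^ 'n) set \<Rightarrow> bool" where
  "associated_star_body M \<alpha> \<xi> F \<longleftrightarrow>
     (\<exists>\<sigma>. spectral_measure M \<alpha> \<xi> \<sigma> \<and> F = {u. stable_gauge \<alpha> \<sigma> u \<le> 1})"

definition zero_coord :: "'n \<Rightarrow> real ^ 'n \<Rightarrow> real ^ 'n" where
  "zero_coord j x = (\<chi> i. if i = j then 0 else x $ i)"

definition coord_diff :: "'n \<Rightarrow> (real ^ 'n \<Rightarrow> real) \<Rightarrow> real ^ 'n \<Rightarrow> real" where
  "coord_diff j g = (\<lambda>x. g x - g (zero_coord j x))"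

text \<open>
  The composition of \<open>coord_diff j\<close> over all coordinates \<open>j\<close>. The operators commute, so the fold
  over the index type does not depend on an order of the coordinates.
\<close>

definition all_coord_diff :: "(real ^ 'n \<Rightarrow> real) \<Rightarrow> real ^ 'n \<Rightarrow> real" where
  "all_coord_diff g = Finite_Set.fold coord_diff g UNIV"

lemma zero_coord_commute: "zero_coord i (zero_coord j x) = zero_coord j (zero_coord i x)"
  by (auto simp: zero_coord_def vec_eq_iff)

lemma comp_fun_commute_coord_diff: "comp_fun_commute coord_diff"
  by unfold_locales (auto simp: coord_diff_def fun_eq_iff zero_coord_commute)

lemma all_coord_diff_eq_foldr:
  fixes js :: "'n::finite list"
  assumes "distinct js" "set js = UNIV"
  shows "all_coord_diff g = foldr coord_diff js g"
proof -
  interpret comp_fun_commute "coord_diff :: 'n \<Rightarrow> _"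
    by (rule comp_fun_commute_coord_diff)
  have "Finite_Set.fold coord_diff g (set js) = foldr coord_diff js g"
    using assms(1) by (induction js) auto
  thus ?thesis by (simp add: all_coord_diff_def assms(2))
qed

text \<open>
  The integrand \<open>\<Prod>\<^sub>i \<bar>u\<^sub>i\<bar>\<^bsup>- lam\<^sub>i - 1\<^esup> (\<Delta>\<^sub>1 \<dots> \<Delta>\<^sub>d 1\<^sub>F)(u)\<close> is singular along the coordinate hyperplanes.
  It is Lebesgue integrable if \<open>\<Sum>\<^sub>i lam\<^sub>i < 1\<close>, but need not be otherwise. For instance, let \<open>d = 2\<close>, \<open>\<alpha> = 2\<close> and
  \<open>F = {u. u\<^sub>1\<^sup>2 + u\<^sub>1 u\<^sub>2 + u\<^sub>2\<^sup>2 \<le> 1}\<close>. For small \<open>u\<^sub>1 > 0\<close> the difference equals \<open>-1\<close> on an interval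
  of values \<open>u\<^sub>2\<close> of length about \<open>u\<^sub>1 / 2\<close> ending at \<open>1\<close>, so the integral of the absolute value is
  at least a multiple of that of \<open>u\<^sub>1\<^bsup>- lam\<^sub>1\<^esup>\<close> near 0, which diverges for \<open>lam\<^sub>1 \<ge> 1\<close>. The integral
  is therefore taken as a principal value: conical neighbourhoods of the coordinate hyperplanes are cut out
  symmetrically and shrunk. It agrees with the Lebesgue integral of every integrable function.
\<close>

definition off_hyperplanes :: "real \<Rightarrow> (real ^ 'n) set" where
  "off_hyperplanes \<epsilon> = {u. \<forall>i. \<epsilon> * norm u < \<bar>u $ i\<bar>}"

definition has_pv_integral :: "(real ^ 'n \<Rightarrow> real) \<Rightarrow> real \<Rightarrow> bool" where
  "has_pv_integral f I \<longleftrightarrow>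
     (\<forall>\<epsilon>>0. set_integrable lborel (off_hyperplanes \<epsilon>) f) \<and>
     ((\<lambda>\<epsilon>. LINT u:off_hyperplanes \<epsilon>|lborel. f u) \<longlongrightarrow> I) (at_right 0)"

definition pv_integrable :: "(real ^ 'n \<Rightarrow> real) \<Rightarrow> bool" where
  "pv_integrable f \<longleftrightarrow> (\<exists>I. has_pv_integral f I)"

definition pv_integral :: "(real ^ 'n \<Rightarrow> real) \<Rightarrow> real" where
  "pv_integral f = (THE I. has_pv_integral f I)"

lemma has_pv_integral_unique:
  assumes "has_pv_integral f I" "has_pv_integral f J"
  shows "I = J"
  using assms tendsto_unique[of "at_right (0::real)"]
  by (auto simp: has_pv_integral_def)

lemma pv_integral_eqI: "has_pv_integral f I \<Longrightarrow> pv_integral f = I"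
  unfolding pv_integral_def by (blast intro: has_pv_integral_unique)

lemma off_hyperplanes_measurable [measurable]: "(off_hyperplanes \<epsilon> :: (real ^ 'n) set) \<in> sets borel"
proof -
  have "off_hyperplanes \<epsilon> = (\<Inter>i. {u :: real ^ 'n. \<epsilon> * norm u < \<bar>u $ i\<bar>})"
    by (auto simp: off_hyperplanes_def)
  also have "open \<dots>"
    by (intro open_INT finite ballI open_Collect_less continuous_intros)
  finally show ?thesis by simp
qed

lemma AE_coord_nonzero: "AE u :: real ^ 'n in lborel. \<forall>i. u $ i \<noteq> 0"
proof -
  have "AE u :: real ^ 'n in lborel. u $ i \<noteq> 0" for i
  proof (rule AE_I')
    have "negligible {u :: real ^ 'n. u $ i = 0}"
      using negligible_hyperplane[of "axis i 1 :: real ^ 'n" 0]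
      by (simp add: inner_axis' axis_eq_0_iff)
    moreover have "{u :: real ^ 'n. u $ i = 0} \<in> sets borel"
      by (intro borel_closed closed_Collect_eq continuous_intros)
    ultimately show "{u :: real ^ 'n. u $ i = 0} \<in> null_sets lborel"
      by (simp add: negligible_iff_null_sets null_sets_def)
  qed auto
  thus ?thesis by (simp add: AE_all_countable)
qed

lemma has_pv_integral_lebesgue:
  fixes f :: "real ^ 'n \<Rightarrow> real"
  assumes f: "integrable lborel f"
  shows "has_pv_integral f (LINT u|lborel. f u)"
  unfolding has_pv_integral_def
proof (intro conjI allI impI)
  show "set_integrable lborel (off_hyperplanes \<epsilon>) f" for \<epsilon>
    unfolding set_integrable_def by (intro integrable_mult_indicator f) auto
  have [measurable]: "f \<in> borel_measurable borel" using f by auto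
  show "((\<lambda>\<epsilon>. LINT u:off_hyperplanes \<epsilon>|lborel. f u) \<longlongrightarrow> (LINT u|lborel. f u)) (at_right 0)"
    unfolding set_lebesgue_integral_def
  proof (rule tendsto_at_right_sequentially[where b = 1])
    fix e :: "nat \<Rightarrow> real"
    assume e: "\<And>n. 0 < e n" "e \<longlonglongrightarrow> 0"
    show "(\<lambda>n. LINT u|lborel. indicator (off_hyperplanes (e n)) u *\<^sub>R f u) \<longlonglongrightarrow> (LINT u|lborel. f u)"
    proof (rule integral_dominated_convergence[where w = "\<lambda>u. norm (f u)"])
      show "AE u in lborel. (\<lambda>n. indicator (off_hyperplanes (e n)) u *\<^sub>R f u) \<longlonglongrightarrow> f u"
        using AE_coord_nonzero
      proof eventually_elim
        case (elim u)
        have "\<forall>\<^sub>F n in sequentially. e n * norm u < \<bar>u $ i\<bar>" for i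
        proof (rule order_tendstoD)
          show "(\<lambda>n. e n * norm u) \<longlonglongrightarrow> 0" using tendsto_mult_left_zero[OF e(2)] .
        qed (use elim in auto)
        hence "\<forall>\<^sub>F n in sequentially. \<forall>i. e n * norm u < \<bar>u $ i\<bar>"
          by (simp add: eventually_all_finite)
        hence "\<forall>\<^sub>F n in sequentially. indicator (off_hyperplanes (e n)) u *\<^sub>R f u = f u"
          by eventually_elim (auto simp: off_hyperplanes_def)
        thus ?case by (rule tendsto_eventually)
      qed
    qed (use f in \<open>auto simp: indicator_def\<close>)
  qed simp
qed

lemma pv_integral_eq_lebesgue:
  "integrable lborel f \<Longrightarrow> pv_integral f = (LINT u|lborel. f u)"
  by (intro pv_integral_eqI has_pv_integral_lebesgue)

definition moment_integrand :: "('n \<Rightarrow> real) \<Rightarrow> (real ^ 'n) set \<Rightarrow> real ^ 'n \<Rightarrow> real" where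
  "moment_integrand lam F u =
     (\<Prod>i\<in>UNIV. \<bar>u $ i\<bar> powr (- lam i - 1)) * all_coord_diff (indicator F) u"

end

theory Submission imports Defs begin

text \<open>
  Up to a constant \<open>\<kappa>\<^sub>p\<close>, \<open>\<bar>x\<bar>\<^sup>p\<close> is the integral of \<open>\<bar>t\<bar> powr (- p - 1) * (1 - cos (t * x))\<close> over all
  real \<open>t\<close>. Multiplying one such identity for each coordinate and taking expectations turns the
  moment, times the product of these constants, into the integral over \<open>u\<close> of the weight
  \<open>\<Prod>\<^sub>i \<bar>u\<^sub>i\<bar> powr (- lam\<^sub>i - 1)\<close> against the nonnegative function
  \<open>\<bold>E \<Prod>\<^sub>i (1 - cos (u\<^sub>i \<xi>\<^sub>i))\<close> (lemma \<open>has_bochner_integral_weight_cos_prod\<close>). Up to the sign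
  \<open>(-1)\<^sup>d\<close>, that function is the average of \<open>\<Delta>\<^sub>1 \<dots> \<Delta>\<^sub>d \<phi>\<close> over the \<open>2\<^sup>d\<close> sign changes of the
  coordinates of \<open>u\<close>, where \<open>\<phi>\<close> is the characteristic function of \<open>\<xi>\<close>
  (lemma \<open>sum_flip_signs_coord_diff_char_fun\<close>).

  The star body enters because \<open>exp (- y)\<close> is the integral of \<open>exp (- r)\<close> over \<open>r \<ge> y\<close>. With
  \<open>y = \<parallel>u\<parallel>\<^sub>F powr \<alpha>\<close> and the homogeneity of the gauge this shows \<open>\<phi>\<close> as a mixture of dilates of
  \<open>1\<^sub>F\<close>: \<open>\<phi>(u)\<close> is the integral of \<open>exp (- r) * 1\<^sub>F (r powr (- 1 / \<alpha>) *\<^sub>R u)\<close> over \<open>r > 0\<close>. The weight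
  is homogeneous of degree \<open>- d - \<lambda>\<close>, where \<open>\<lambda>\<close> is the sum of the exponents. Hence the dilate with
  parameter \<open>r\<close> contributes \<open>r powr (- \<lambda> / \<alpha>)\<close> times the contribution of \<open>1\<^sub>F\<close>, and integrating over
  \<open>r\<close> produces the factor \<open>\<Gamma>(1 - \<lambda> / \<alpha>)\<close>.

  The interchange of integrals in the last step requires absolute convergence. It holds on every
  cone \<open>off_hyperplanes \<epsilon>\<close>: there all coordinates are comparable with the norm and the integrand
  vanishes near the origin. The cones are invariant under dilations and sign changes, so that the
  whole computation takes place on each cone separately (lemmas \<open>integral_cone_char_fun\<close> and
  \<open>integral_cone_cos_prod\<close>). As \<open>\<epsilon>\<close> tends to \<open>0\<close>, the integrals of the nonnegative function above
  converge to its integral over the whole space, and with them the principal value.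

  Two facts come from the one-dimensional case applied to the projections \<open>\<langle>\<xi>, v\<rangle>\<close>: for \<open>0 < p < \<alpha>\<close>,
  \<open>\<parallel>v\<parallel>\<^sub>F powr p\<close> is a constant multiple of \<open>\<bold>E \<bar>\<langle>\<xi>, v\<rangle>\<bar> powr p\<close> (lemma \<open>nn_integral_abs_inner_powr\<close>).
  Thus the moment is finite, and for \<open>p \<le> 1\<close> the function \<open>\<parallel>v\<parallel>\<^sub>F powr p\<close> inherits subadditivity from
  \<open>\<bar>x\<bar> powr p\<close>, whether \<open>F\<close> is convex or not.

  If \<open>\<lambda> < 1\<close>, this subadditivity with \<open>p = \<lambda>\<close> controls the singularity at the hyperplanes. Integrated
  over all dilates with respect to \<open>s powr (\<lambda> - 1) ds\<close>, the modulus of \<open>\<Delta>\<^sub>1 \<dots> \<Delta>\<^sub>d 1\<^sub>F (v / s)\<close> is at most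
  a constant times \<open>\<bar>v\<^sub>i\<bar> powr \<lambda>\<close> for each \<open>i\<close>, hence for the smallest coordinate. This factor can be
  spread over the coordinates so as to leave a product of integrable powers
  (lemmas \<open>nn_integral_scale_body_diff_le\<close> and \<open>weight_times_min_powr_le\<close>).
\<close>

section \<open>Power and exponential integrals on the line\<close>

lemma nn_integral_abs:
  fixes f :: "real \<Rightarrow> ennreal"
  assumes [measurable]: "f \<in> borel_measurable borel"
  shows "(\<integral>\<^sup>+t. f \<bar>t\<bar> \<partial>lborel) = 2 * (\<integral>\<^sup>+t. f t * indicator {0..} t \<partial>lborel)"
proof -
  have "(\<integral>\<^sup>+t. f \<bar>t\<bar> \<partial>lborel) =
      (\<integral>\<^sup>+t. f t * indicator {0..} t + f (-t) * indicator {..<0} t \<partial>lborel)"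
    by (intro nn_integral_cong) (auto simp: indicator_def)
  also have "\<dots> = (\<integral>\<^sup>+t. f t * indicator {0..} t \<partial>lborel) + (\<integral>\<^sup>+t. f (-t) * indicator {..<0} t \<partial>lborel)"
    by (rule nn_integral_add) auto
  also have "(\<integral>\<^sup>+t. f (-t) * indicator {..<0} t \<partial>lborel) =
      (\<integral>\<^sup>+t. f t * indicator {..<0} (-t) \<partial>lborel)"
    by (subst nn_integral_real_affine[where c = "-1" and t = 0]) auto
  also have "\<dots> = (\<integral>\<^sup>+t. f t * indicator {0..} t \<partial>lborel)"
  proof (rule nn_integral_cong_AE)
    have "AE t in lborel. t \<noteq> (0::real)"
      by (rule AE_lborel_singleton)
    thus "AE t in lborel. f t * indicator {..<0} (-t) = f t * indicator {0..} t"
      by eventually_elim (auto simp: indicator_def)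
  qed
  finally show ?thesis by (simp add: mult_2)
qed

lemma nn_integral_powr_atLeast:
  fixes c :: real
  assumes "0 < c" "0 < p"
  shows "(\<integral>\<^sup>+t. ennreal (t powr (- p - 1)) * indicator {c..} t \<partial>lborel) = ennreal (c powr - p / p)"
proof -
  have "(\<integral>\<^sup>+t. ennreal (t powr (- p - 1)) * indicator {c..} t \<partial>lborel) =
      ennreal (0 - (- (c powr - p) / p))"
  proof (rule nn_integral_FTC_atLeast)
    fix x assume "c \<le> x"
    hence "0 < x" using assms by simp
    thus "((\<lambda>x. - (x powr - p) / p) has_real_derivative x powr (- p - 1)) (at x)"
      using assms by (auto intro!: derivative_eq_intros)
  next
    have "((\<lambda>x::real. x powr - p) \<longlongrightarrow> 0) at_top"
      using assms by (intro tendsto_neg_powr filterlim_ident) auto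
    hence "((\<lambda>x. - (x powr - p) / p) \<longlongrightarrow> - 0 / p) at_top"
      using assms by (intro tendsto_intros) auto
    thus "((\<lambda>x. - (x powr - p) / p) \<longlongrightarrow> 0) at_top" by simp
  qed auto
  thus ?thesis by simp
qed

lemma nn_integral_powr_Icc:
  fixes c :: real
  assumes "-1 < p" "0 \<le> c"
  shows "(\<integral>\<^sup>+t. ennreal (t powr p) * indicator {0..c} t \<partial>lborel) = ennreal (c powr (p + 1) / (p + 1))"
  using nn_integral_has_integral_lebesgue'[OF _ has_integral_powr_from_0[OF assms]] by simp

lemma exp_eq_tail_integral:
  fixes y :: real
  shows "(\<integral>\<^sup>+r. ennreal (exp (- r)) * indicator {y..} r \<partial>lborel) = ennreal (exp (- y))"
proof -
  have "(\<integral>\<^sup>+r. ennreal (exp (- r)) * indicator {y..} r \<partial>lborel) = ennreal (0 - (- exp (- y)))"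
  proof (rule nn_integral_FTC_atLeast)
    have "((\<lambda>x::real. exp (- x)) \<longlongrightarrow> 0) at_top"
      by (rule filterlim_compose[OF exp_at_bot filterlim_uminus_at_bot_at_top])
    thus "((\<lambda>x::real. - exp (- x)) \<longlongrightarrow> 0) at_top"
      by (auto dest: tendsto_minus)
  qed (auto intro!: derivative_eq_intros)
  thus ?thesis by simp
qed

lemma one_minus_exp_eq_integral:
  fixes y :: real
  assumes "0 \<le> y"
  shows "(\<integral>\<^sup>+r. ennreal (exp (- r)) * indicator {0..y} r \<partial>lborel) = ennreal (1 - exp (- y))"
proof -
  have "(\<integral>\<^sup>+r. ennreal (exp (- r)) * indicator {0..y} r \<partial>lborel) = ennreal (- exp (- y) - (- exp (- 0)))"
  proof (rule nn_integral_FTC_Icc)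
  qed (use assms in \<open>auto intro!: derivative_eq_intros\<close>)
  thus ?thesis by simp
qed

lemma nn_integral_Gamma:
  fixes s :: real
  assumes "0 < s"
  shows "(\<integral>\<^sup>+r. ennreal (r powr (s - 1)) * (ennreal (exp (- r)) * indicator {0..} r) \<partial>lborel) = ennreal (Gamma s)"
  unfolding Gamma_conv_nn_integral_real[OF assms]
  by (intro nn_integral_cong)
    (auto simp: indicator_def exp_minus divide_inverse ennreal_mult'[symmetric])

text \<open>
  Writing \<open>1 - exp (- y)\<close> as the integral of \<open>exp (- r)\<close> over \<open>0 \<le> r \<le> y\<close> and integrating over \<open>t\<close>
  first leaves a pure power of \<open>t\<close> on a half line, and then a Gamma integral in \<open>r\<close>.
\<close>

lemma nn_integral_powr_one_minus_exp:
  fixes a :: real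
  assumes "0 < p" "p < \<alpha>" "0 \<le> a"
  shows "(\<integral>\<^sup>+t. ennreal (\<bar>t\<bar> powr (- p - 1) * (1 - exp (- ((\<bar>t\<bar> * a) powr \<alpha>)))) \<partial>lborel) =
    ennreal (2 / p * a powr p * Gamma (1 - p / \<alpha>))"
proof (cases "a = 0")
  case False
  hence a: "a > 0" using assms by simp
  have \<alpha>: "\<alpha> > 0" using assms by simp
  have "(\<integral>\<^sup>+t. ennreal (\<bar>t\<bar> powr (- p - 1) * (1 - exp (- ((\<bar>t\<bar> * a) powr \<alpha>)))) \<partial>lborel) =
    2 * (\<integral>\<^sup>+t. ennreal (t powr (- p - 1) * (1 - exp (- ((t * a) powr \<alpha>)))) * indicator {0..} t \<partial>lborel)"
    by (rule nn_integral_abs[where f = "\<lambda>t. ennreal (t powr (- p - 1) * (1 - exp (- ((t * a) powr \<alpha>))))"]) auto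
  also have "(\<integral>\<^sup>+t. ennreal (t powr (- p - 1) * (1 - exp (- ((t * a) powr \<alpha>)))) * indicator {0..} t \<partial>lborel) =
      (\<integral>\<^sup>+t. \<integral>\<^sup>+r. ennreal (t powr (- p - 1)) * indicator {0..} t *
        (ennreal (exp (- r)) * indicator {0..(t * a) powr \<alpha>} r) \<partial>lborel \<partial>lborel)"
    by (intro nn_integral_cong, subst nn_integral_cmult)
      (auto simp: one_minus_exp_eq_integral ennreal_mult' mult_ac)
  also have "\<dots> = (\<integral>\<^sup>+r. \<integral>\<^sup>+t. ennreal (t powr (- p - 1)) * indicator {0..} t *
        (ennreal (exp (- r)) * indicator {0..(t * a) powr \<alpha>} r) \<partial>lborel \<partial>lborel)"
    by (rule lborel_pair.Fubini') (simp add: indicator_def, measurable)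
  also have "\<dots> = (\<integral>\<^sup>+r. ennreal (a powr p / p) *
      (ennreal (r powr (1 - p / \<alpha> - 1)) * (ennreal (exp (- r)) * indicator {0..} r)) \<partial>lborel)"
  proof (rule nn_integral_cong_AE)
    have "AE r in lborel. r \<noteq> (0::real)"
      by (rule AE_lborel_singleton)
    thus "AE r in lborel. (\<integral>\<^sup>+t. ennreal (t powr (- p - 1)) * indicator {0..} t *
        (ennreal (exp (- r)) * indicator {0..(t * a) powr \<alpha>} r) \<partial>lborel) =
      ennreal (a powr p / p) * (ennreal (r powr (1 - p / \<alpha> - 1)) * (ennreal (exp (- r)) * indicator {0..} r))"
    proof eventually_elim
      case (elim r)
      show ?case
      proof (cases "r < 0")
        case False
        hence r: "r > 0" using elim by simp
        have iff: "r \<le> (t * a) powr \<alpha> \<longleftrightarrow> r powr (1/\<alpha>) / a \<le> t" if "0 \<le> t" for t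
        proof -
          have "r \<le> (t * a) powr \<alpha> \<longleftrightarrow> (r powr (1/\<alpha>)) powr \<alpha> \<le> (t * a) powr \<alpha>"
            using r \<alpha> by (simp add: powr_powr)
          also have "\<dots> \<longleftrightarrow> r powr (1/\<alpha>) \<le> t * a"
            using r \<alpha> a that by (smt (verit) mult_nonneg_nonneg powr_ge_zero powr_less_mono2 powr_mono2)
          finally show ?thesis using a by (simp add: field_simps)
        qed
        have "(\<integral>\<^sup>+t. ennreal (t powr (- p - 1)) * indicator {0..} t *
            (ennreal (exp (- r)) * indicator {0..(t * a) powr \<alpha>} r) \<partial>lborel) =
          (\<integral>\<^sup>+t. ennreal (exp (- r)) * (ennreal (t powr (- p - 1)) * indicator {r powr (1/\<alpha>) / a..} t) \<partial>lborel)"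
        proof (intro nn_integral_cong)
          fix t
          have "0 < r powr (1/\<alpha>) / a" using r a by simp
          thus "ennreal (t powr (- p - 1)) * indicator {0..} t *
            (ennreal (exp (- r)) * indicator {0..(t * a) powr \<alpha>} r) =
            ennreal (exp (- r)) * (ennreal (t powr (- p - 1)) * indicator {r powr (1/\<alpha>) / a..} t)"
            using iff[of t] r by (cases "0 \<le> t") (auto simp: indicator_def mult_ac)
        qed
        also have "\<dots> = ennreal (exp (- r)) * ennreal ((r powr (1/\<alpha>) / a) powr - p / p)"
          using r a assms by (subst nn_integral_cmult) (auto simp: nn_integral_powr_atLeast)
        also have "(r powr (1/\<alpha>) / a) powr - p = a powr p * r powr (1 - p / \<alpha> - 1)"
          using r a by (simp add: powr_divide powr_powr powr_minus field_simps)
        finally show ?thesis using r assms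
          by (simp add: ennreal_mult'[symmetric] mult_ac)
      qed (simp add: indicator_def)
    qed
  qed
  also have "\<dots> = ennreal (a powr p / p) * ennreal (Gamma (1 - p / \<alpha>))"
    using assms nn_integral_Gamma[of "1 - p / \<alpha>"] by (subst nn_integral_cmult) auto
  also have "2 * \<dots> = ennreal (2 * (a powr p / p * Gamma (1 - p / \<alpha>)))"
    using assms by (simp add: numeral_mult_ennreal ennreal_mult'[symmetric])
  finally show ?thesis by (simp add: mult_ac)
qed (use assms in simp)

text \<open>
  The factor \<open>exp (- x\<^sup>2 / 2)\<close> is the integral of \<open>exp (- r)\<close> over \<open>r \<ge> x\<^sup>2 / 2\<close>; Tonelli's theorem then
  replaces the substitution \<open>r = x\<^sup>2 / 2\<close> in the usual computation of the absolute moments.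
\<close>

lemma nn_integral_std_normal_abs_powr:
  fixes p :: real
  assumes "0 < p"
  shows "(\<integral>\<^sup>+x. ennreal (\<bar>x\<bar> powr p * std_normal_density x) \<partial>lborel) =
    ennreal (2 powr (p / 2) * Gamma ((p + 1) / 2) / sqrt pi)"
proof -
  define C where "C = 1 / sqrt (2 * pi)"
  have C: "C > 0" by (simp add: C_def)
  have "(\<integral>\<^sup>+x. ennreal (\<bar>x\<bar> powr p * std_normal_density x) \<partial>lborel) =
    2 * (\<integral>\<^sup>+x. ennreal (x powr p * std_normal_density x) * indicator {0..} x \<partial>lborel)"
    by (subst nn_integral_abs[symmetric]) (auto simp: std_normal_density_def)
  also have "(\<integral>\<^sup>+x. ennreal (x powr p * std_normal_density x) * indicator {0..} x \<partial>lborel) =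
    (\<integral>\<^sup>+x. \<integral>\<^sup>+r. ennreal (x powr p * C) * indicator {0..} x *
        (ennreal (exp (- r)) * indicator {x\<^sup>2 / 2..} r) \<partial>lborel \<partial>lborel)"
    using C
    by (intro nn_integral_cong, subst nn_integral_cmult)
      (auto simp: exp_eq_tail_integral ennreal_mult'[symmetric] std_normal_density_def C_def mult_ac)
  also have "\<dots> = (\<integral>\<^sup>+r. \<integral>\<^sup>+x. ennreal (x powr p * C) * indicator {0..} x *
        (ennreal (exp (- r)) * indicator {x\<^sup>2 / 2..} r) \<partial>lborel \<partial>lborel)"
    by (rule lborel_pair.Fubini') (simp add: indicator_def, measurable)
  also have "\<dots> = (\<integral>\<^sup>+r. ennreal (C * 2 powr ((p + 1) / 2) / (p + 1)) *
      (ennreal (r powr ((p + 1) / 2 + 1 - 1)) * (ennreal (exp (- r)) * indicator {0..} r)) \<partial>lborel)"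
  proof (intro nn_integral_cong)
    fix r :: real
    show "(\<integral>\<^sup>+x. ennreal (x powr p * C) * indicator {0..} x *
        (ennreal (exp (- r)) * indicator {x\<^sup>2 / 2..} r) \<partial>lborel) =
      ennreal (C * 2 powr ((p + 1) / 2) / (p + 1)) *
      (ennreal (r powr ((p + 1) / 2 + 1 - 1)) * (ennreal (exp (- r)) * indicator {0..} r))"
    proof (cases "r < 0")
      case True
      hence "\<not> x\<^sup>2 / 2 \<le> r" for x by (smt (verit) zero_le_power2 divide_nonneg_nonneg)
      thus ?thesis using True by (simp add: indicator_def)
    next
      case False
      have iff: "x\<^sup>2 / 2 \<le> r \<longleftrightarrow> x \<le> sqrt (2 * r)" if "0 \<le> x" for x
        using that False by (simp add: real_le_rsqrt) (smt (verit) real_le_rsqrt real_sqrt_le_iff real_sqrt_abs)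
      have "(\<integral>\<^sup>+x. ennreal (x powr p * C) * indicator {0..} x *
        (ennreal (exp (- r)) * indicator {x\<^sup>2 / 2..} r) \<partial>lborel) =
        (\<integral>\<^sup>+x. ennreal (C * exp (- r)) * (ennreal (x powr p) * indicator {0..sqrt (2 * r)} x) \<partial>lborel)"
        using iff C by (intro nn_integral_cong) (auto simp: indicator_def ennreal_mult'[symmetric] mult_ac)
      also have "\<dots> = ennreal (C * exp (- r)) * ennreal (sqrt (2 * r) powr (p + 1) / (p + 1))"
        using False assms by (subst nn_integral_cmult) (auto simp: nn_integral_powr_Icc)
      also have "sqrt (2 * r) powr (p + 1) = 2 powr ((p + 1) / 2) * r powr ((p + 1) / 2)"
        using False by (simp add: powr_half_sqrt[symmetric] powr_powr powr_mult)
      finally show ?thesis using False C assms by (simp add: ennreal_mult'[symmetric] mult_ac)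
    qed
  qed
  also have "\<dots> = ennreal (C * 2 powr ((p + 1) / 2) / (p + 1)) * ennreal (Gamma ((p + 1) / 2 + 1))"
    using assms by (subst nn_integral_cmult, simp, subst nn_integral_Gamma) (auto intro!: add_pos_pos)
  also have "2 * \<dots> = ennreal (2 * (C * 2 powr ((p + 1) / 2) / (p + 1) * Gamma ((p + 1) / 2 + 1)))"
    using assms C Gamma_real_pos[of "(p + 1) / 2 + 1"] add_pos_pos[of "(p + 1) / 2" 1] by (simp add: numeral_mult_ennreal ennreal_mult'[symmetric])
  also have "Gamma ((p + 1) / 2 + 1) = (p + 1) / 2 * Gamma ((p + 1) / 2)"
    using assms by (subst Gamma_plus1) (auto simp: nonpos_Ints_def)
  also have "2 * (C * 2 powr ((p + 1) / 2) / (p + 1) * ((p + 1) / 2 * Gamma ((p + 1) / 2))) =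
      C * 2 powr (p / 2 + 1 / 2) * Gamma ((p + 1) / 2)"
    using assms by (simp add: field_simps)
  also have "C * 2 powr (p / 2 + 1 / 2) = 2 powr (p / 2) / sqrt pi"
    unfolding powr_add C_def by (simp add: powr_half_sqrt real_sqrt_mult)
  finally show ?thesis by simp
qed

section \<open>Fractional moments from the characteristic function\<close>

lemma nn_integral_cos_kernel_scale:
  fixes x :: real
  assumes "0 < p"
  shows "(\<integral>\<^sup>+t. ennreal (\<bar>t\<bar> powr (- p - 1) * (1 - cos (t * x))) \<partial>lborel) =
    ennreal (\<bar>x\<bar> powr p) * (\<integral>\<^sup>+t. ennreal (\<bar>t\<bar> powr (- p - 1) * (1 - cos t)) \<partial>lborel)"
proof (cases "x = 0")
  case False
  let ?I = "\<integral>\<^sup>+t. ennreal (\<bar>t\<bar> powr (- p - 1) * (1 - cos (t * x))) \<partial>lborel"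
  have "(\<integral>\<^sup>+t. ennreal (\<bar>t\<bar> powr (- p - 1) * (1 - cos t)) \<partial>lborel) =
    ennreal \<bar>x\<bar> * (\<integral>\<^sup>+t. ennreal (\<bar>x * t\<bar> powr (- p - 1) * (1 - cos (x * t))) \<partial>lborel)"
    using False by (subst nn_integral_real_affine[where c = x and t = 0]) auto
  also have "(\<integral>\<^sup>+t. ennreal (\<bar>x * t\<bar> powr (- p - 1) * (1 - cos (x * t))) \<partial>lborel) =
    (\<integral>\<^sup>+t. ennreal (\<bar>x\<bar> powr (- p - 1)) * ennreal (\<bar>t\<bar> powr (- p - 1) * (1 - cos (t * x))) \<partial>lborel)"
    by (intro nn_integral_cong)
      (simp add: ennreal_mult'[symmetric] abs_mult powr_mult mult_ac)
  also have "\<dots> = ennreal (\<bar>x\<bar> powr (- p - 1)) * ?I"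
    by (rule nn_integral_cmult) auto
  finally have "ennreal (\<bar>x\<bar> powr p) * (\<integral>\<^sup>+t. ennreal (\<bar>t\<bar> powr (- p - 1) * (1 - cos t)) \<partial>lborel) =
    ennreal (\<bar>x\<bar> powr p * (\<bar>x\<bar> * \<bar>x\<bar> powr (- p - 1))) * ?I"
    by (simp add: ennreal_mult' mult.assoc)
  also have "\<bar>x\<bar> powr p * (\<bar>x\<bar> * \<bar>x\<bar> powr (- p - 1)) = 1"
    using False by (simp add: powr_diff powr_minus field_simps)
  finally show ?thesis by simp
qed simp

text \<open>
  Tonelli's theorem for \<open>\<bar>t\<bar> powr (- p - 1) * (1 - cos (t * X))\<close>: integrating over \<open>t\<close> first gives a
  multiple of \<open>\<bar>X\<bar> powr p\<close>, taking the expectation first gives the integral of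
  \<open>nn_integral_powr_one_minus_exp\<close>. The value of the cosine integral is left open here, because this
  identity is what determines it below.
\<close>

lemma (in prob_space) nn_integral_abs_powr_times_cos_kernel:
  fixes X :: "'a \<Rightarrow> real"
  assumes X [measurable]: "random_variable borel X"
    and char_X: "\<And>t. expectation (\<lambda>\<omega>. cos (t * X \<omega>)) = exp (- ((\<bar>t\<bar> * a) powr \<alpha>))"
    and p: "0 < p" "p < \<alpha>" and a: "0 \<le> a"
  shows "(\<integral>\<^sup>+\<omega>. ennreal (\<bar>X \<omega>\<bar> powr p) \<partial>M) *
      (\<integral>\<^sup>+t. ennreal (\<bar>t\<bar> powr (- p - 1) * (1 - cos t)) \<partial>lborel) =
    ennreal (2 / p * a powr p * Gamma (1 - p / \<alpha>))"
proof -
  interpret pair_sigma_finite M lborel by unfold_locales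
  have "(\<integral>\<^sup>+\<omega>. ennreal (\<bar>X \<omega>\<bar> powr p) \<partial>M) *
      (\<integral>\<^sup>+t. ennreal (\<bar>t\<bar> powr (- p - 1) * (1 - cos t)) \<partial>lborel) =
    (\<integral>\<^sup>+\<omega>. \<integral>\<^sup>+t. ennreal (\<bar>t\<bar> powr (- p - 1) * (1 - cos (t * X \<omega>))) \<partial>lborel \<partial>M)"
    using p by (subst nn_integral_multc[symmetric]) (auto simp: nn_integral_cos_kernel_scale)
  also have "\<dots> = (\<integral>\<^sup>+t. \<integral>\<^sup>+\<omega>. ennreal (\<bar>t\<bar> powr (- p - 1) * (1 - cos (t * X \<omega>))) \<partial>M \<partial>lborel)"
    by (rule Fubini'[symmetric]) measurable
  also have "\<dots> = (\<integral>\<^sup>+t. ennreal (\<bar>t\<bar> powr (- p - 1) * (1 - exp (- ((\<bar>t\<bar> * a) powr \<alpha>)))) \<partial>lborel)"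
  proof (intro nn_integral_cong)
    fix t :: real
    have int: "integrable M (\<lambda>\<omega>. cos (t * X \<omega>))"
      by (intro integrable_const_bound[where B = 1]) auto
    have "(\<integral>\<^sup>+\<omega>. ennreal (\<bar>t\<bar> powr (- p - 1) * (1 - cos (t * X \<omega>))) \<partial>M) =
        ennreal (expectation (\<lambda>\<omega>. \<bar>t\<bar> powr (- p - 1) * (1 - cos (t * X \<omega>))))"
      using int by (intro nn_integral_eq_integral) auto
    also have "expectation (\<lambda>\<omega>. \<bar>t\<bar> powr (- p - 1) * (1 - cos (t * X \<omega>))) =
        \<bar>t\<bar> powr (- p - 1) * (1 - exp (- ((\<bar>t\<bar> * a) powr \<alpha>)))"
      using int by (simp add: char_X prob_space)
    finally show "(\<integral>\<^sup>+\<omega>. ennreal (\<bar>t\<bar> powr (- p - 1) * (1 - cos (t * X \<omega>))) \<partial>M) =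
        ennreal (\<bar>t\<bar> powr (- p - 1) * (1 - exp (- ((\<bar>t\<bar> * a) powr \<alpha>))))" .
  qed
  also have "\<dots> = ennreal (2 / p * a powr p * Gamma (1 - p / \<alpha>))"
    by (rule nn_integral_powr_one_minus_exp) (use p a in auto)
  finally show ?thesis .
qed

text \<open>
  The constant \<open>\<kappa>\<^sub>p\<close> for which \<open>\<kappa>\<^sub>p * \<bar>x\<bar> powr p\<close> is the integral of
  \<open>\<bar>t\<bar> powr (- p - 1) * (1 - cos (t * x))\<close>.
\<close>

definition cos_kernel_const :: "real \<Rightarrow> real" where
  "cos_kernel_const p = 2 powr (1 - p) * sqrt pi * Gamma (1 - p / 2) / (p * Gamma ((p + 1) / 2))"

lemma cos_kernel_const_pos: "0 < p \<Longrightarrow> p < 2 \<Longrightarrow> 0 < cos_kernel_const p"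
  by (simp add: cos_kernel_const_def)

text \<open>
  Instead of evaluating this oscillatory integral directly, it is read off from the standard normal
  distribution, for which the absolute moments and the characteristic function are both known.
\<close>

lemma nn_integral_cos_kernel:
  fixes p :: real
  assumes p: "0 < p" "p < 2"
  shows "(\<integral>\<^sup>+t. ennreal (\<bar>t\<bar> powr (- p - 1) * (1 - cos t)) \<partial>lborel) = ennreal (cos_kernel_const p)"
    (is "?K = _")
proof -
  interpret prob_space std_normal_distribution
    by (rule real_distribution.axioms(1)[OF real_dist_normal_dist])
  define A where "A = 2 powr (p / 2) * Gamma ((p + 1) / 2) / sqrt pi"
  define B where "B = 2 / p * (1 / sqrt 2) powr p * Gamma (1 - p / 2)"
  have A: "A > 0" using p by (simp add: A_def)
  have "(\<integral>\<^sup>+x. ennreal (\<bar>x\<bar> powr p) \<partial>std_normal_distribution) * ?K = ennreal B"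
    unfolding B_def
  proof (rule nn_integral_abs_powr_times_cos_kernel)
    fix t :: real
    have int: "integrable std_normal_distribution (\<lambda>x. iexp (t * x))"
      by (intro integrable_const_bound[where B = 1]) auto
    have "expectation (\<lambda>x. cos (t * x)) = Re (char std_normal_distribution t)"
      unfolding char_def by (subst integral_Re[OF int, symmetric]) (simp add: Re_exp)
    also have "\<dots> = exp (- ((\<bar>t\<bar> * (1 / sqrt 2)) powr 2))"
      by (simp add: char_std_normal_distribution power_divide)
    finally show "expectation (\<lambda>x. cos (t * x)) = exp (- ((\<bar>t\<bar> * (1 / sqrt 2)) powr 2))" .
  qed (use p in auto)
  also have "(\<integral>\<^sup>+x. ennreal (\<bar>x\<bar> powr p) \<partial>std_normal_distribution) = ennreal A"
    unfolding A_def nn_integral_std_normal_abs_powr[OF p(1), symmetric]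
    by (subst nn_integral_density) (auto simp: ennreal_mult'[symmetric] mult_ac)
  \<comment> \<open>The moment \<open>A\<close> is finite and nonzero, so it can be cancelled; this also shows that \<open>?K\<close> is finite.\<close>
  finally have "ennreal A * ?K = ennreal A * ennreal (B / A)"
    using A by (simp add: ennreal_mult'[symmetric])
  hence "?K = ennreal (B / A)"
    using A by (simp add: ennreal_mult_cancel_left)
  also have "B / A = cos_kernel_const p"
  proof -
    define x where "x = (2::real) powr (p / 2)"
    have sqrt2: "(1 / sqrt 2) powr p = 1 / x"
      by (simp add: x_def powr_divide powr_half_sqrt[symmetric] powr_powr)
    have two: "2 powr (1 - p) = 2 / (x * x)"
      by (simp add: x_def powr_diff powr_add[symmetric])
    have "2 / p * (1 / x) * H / (x * G / q) = 2 / (x * x) * q * H / (p * G)" for G H q :: real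
      by (simp add: mult_ac)
    thus ?thesis by (simp only: A_def B_def cos_kernel_const_def sqrt2 two x_def[symmetric])
  qed
  finally show ?thesis .
qed

lemma (in prob_space) nn_integral_abs_powr_of_char:
  fixes X :: "'a \<Rightarrow> real"
  assumes "random_variable borel X"
    and "\<And>t. expectation (\<lambda>\<omega>. cos (t * X \<omega>)) = exp (- ((\<bar>t\<bar> * a) powr \<alpha>))"
    and p: "0 < p" "p < \<alpha>" "\<alpha> \<le> 2" and "0 \<le> a"
  shows "(\<integral>\<^sup>+\<omega>. ennreal (\<bar>X \<omega>\<bar> powr p) \<partial>M) =
    ennreal (2 / p * Gamma (1 - p / \<alpha>) / cos_kernel_const p * a powr p)"
proof -
  have K: "cos_kernel_const p > 0" using p by (intro cos_kernel_const_pos) auto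
  have "ennreal (cos_kernel_const p) * (\<integral>\<^sup>+\<omega>. ennreal (\<bar>X \<omega>\<bar> powr p) \<partial>M) =
      ennreal (2 / p * a powr p * Gamma (1 - p / \<alpha>))"
    using nn_integral_abs_powr_times_cos_kernel[OF assms(1,2) p(1,2) assms(6)] p
    by (subst mult.commute) (simp add: nn_integral_cos_kernel)
  also have "\<dots> = ennreal (cos_kernel_const p) *
      ennreal (2 / p * Gamma (1 - p / \<alpha>) / cos_kernel_const p * a powr p)"
    using K by (simp add: ennreal_mult'[symmetric] mult_ac)
  finally show ?thesis using K by (simp add: ennreal_mult_cancel_left)
qed

section \<open>Coordinate differences and the homogeneous weight\<close>

lemma measurable_vec_nth_comp [measurable (raw)]:
  fixes f :: "'b \<Rightarrow> real ^ 'n"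
  assumes "f \<in> M \<rightarrow>\<^sub>M borel"
  shows "(\<lambda>x. f x $ i) \<in> borel_measurable M"
  by (rule measurable_compose[OF assms]) (intro borel_measurable_continuous_onI continuous_intros)

lemma nn_integral_lborel_vec_prod:
  fixes f :: "'n::finite \<Rightarrow> real \<Rightarrow> ennreal"
  assumes [measurable]: "\<And>i. f i \<in> borel_measurable borel"
  shows "(\<integral>\<^sup>+u. (\<Prod>i\<in>UNIV. f i (u $ i)) \<partial>(lborel :: (real ^ 'n) measure)) = (\<Prod>i\<in>UNIV. \<integral>\<^sup>+t. f i t \<partial>lborel)"
proof -
  let ?b = "\<lambda>i. axis i 1 :: real ^ 'n"
  have inj: "inj ?b" by (auto simp: inj_on_def axis_eq_axis)
  have Basis: "Basis = range ?b" by (auto simp: Basis_vec_def)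
  define h where "h b = f (inv ?b b)" for b
  have [measurable]: "h b \<in> borel_measurable borel" for b by (simp add: h_def)
  have [simp]: "h (?b i) = f i" for i by (simp add: h_def inv_f_f[OF inj])
  have "(\<integral>\<^sup>+u. (\<Prod>b\<in>Basis. h b (u \<bullet> b)) \<partial>lborel) = (\<Prod>b\<in>Basis. \<integral>\<^sup>+t. h b t \<partial>lborel)"
    by (rule nn_integral_lborel_prod) auto
  thus ?thesis by (simp add: Basis prod.reindex[OF inj] inner_axis)
qed

definition zero_on :: "'n set \<Rightarrow> real ^ 'n \<Rightarrow> real ^ 'n" where
  "zero_on S u = (\<chi> i. if i \<in> S then 0 else u $ i)"

lemma zero_on_empty [simp]: "zero_on {} u = u"
  by (simp add: zero_on_def vec_eq_iff)

lemma zero_on_zero_coord: "zero_on S (zero_coord j u) = zero_on (insert j S) u"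
  by (auto simp: zero_on_def zero_coord_def vec_eq_iff)

lemma zero_on_scaleR: "zero_on S (c *\<^sub>R u) = c *\<^sub>R zero_on S u"
  by (auto simp: zero_on_def vec_eq_iff)

lemma norm_zero_on_le: "norm (zero_on S u) \<le> norm (u :: real ^ 'n)"
  by (rule norm_le_componentwise_cart) (auto simp: zero_on_def)

lemma measurable_zero_on [measurable]: "zero_on S \<in> borel \<rightarrow>\<^sub>M (borel :: (real ^ 'n) measure)"
proof (intro borel_measurable_continuous_onI, unfold zero_on_def, intro continuous_on_vec_lambda)
  show "continuous_on UNIV (\<lambda>x :: real ^ 'n. if i \<in> S then 0 else x $ i)" for i
    by (cases "i \<in> S") (auto intro!: continuous_intros)
qed

lemma sum_Pow_insert:
  fixes f :: "'b set \<Rightarrow> 'c::comm_monoid_add"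
  assumes "finite A" "a \<notin> A"
  shows "(\<Sum>S\<in>Pow (insert a A). f S) = (\<Sum>S\<in>Pow A. f S + f (insert a S))"
proof -
  have "inj_on (insert a) (Pow A)" using assms(2) by (auto simp: inj_on_def)
  moreover have "Pow A \<inter> insert a ` Pow A = {}" using assms(2) by auto
  ultimately show ?thesis using assms(1)
    by (simp add: Pow_insert sum.union_disjoint sum.reindex sum.distrib)
qed

text \<open>
  Inclusion-exclusion: expanding each factor of \<open>\<Delta>\<^sub>1 \<dots> \<Delta>\<^sub>d\<close> chooses the set of coordinates that are
  replaced by zero.
\<close>

lemma all_coord_diff_eq_sum:
  fixes g :: "real ^ 'n \<Rightarrow> real"
  shows "all_coord_diff g u = (\<Sum>S\<in>Pow UNIV. (-1) ^ card S * g (zero_on S u))"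
proof -
  interpret comp_fun_commute "coord_diff :: 'n \<Rightarrow> _"
    by (rule comp_fun_commute_coord_diff)
  have "Finite_Set.fold coord_diff g A u = (\<Sum>S\<in>Pow A. (-1) ^ card S * g (zero_on S u))" for A :: "'n set"
    using finite[of A]
  proof (induction A arbitrary: u rule: finite_induct)
    case (insert a A)
    have "coord_diff a (Finite_Set.fold coord_diff g A) u =
        Finite_Set.fold coord_diff g A u - Finite_Set.fold coord_diff g A (zero_coord a u)"
      by (subst coord_diff_def) simp
    hence "Finite_Set.fold coord_diff g (insert a A) u =
        (\<Sum>S\<in>Pow A. (-1) ^ card S * g (zero_on S u)) -
        (\<Sum>S\<in>Pow A. (-1) ^ card S * g (zero_on S (zero_coord a u)))"
      using insert by simp
    also have "\<dots> = (\<Sum>S\<in>Pow A. (-1) ^ card S * g (zero_on S u) + (-1) ^ card (insert a S) * g (zero_on (insert a S) u))"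
      unfolding sum_subtractf[symmetric]
    proof (rule sum.cong)
      fix S assume "S \<in> Pow A"
      hence "finite S" "a \<notin> S" using insert finite_subset by auto
      thus "(-1) ^ card S * g (zero_on S u) - (-1) ^ card S * g (zero_on S (zero_coord a u)) =
          (-1) ^ card S * g (zero_on S u) + (-1) ^ card (insert a S) * g (zero_on (insert a S) u)"
        by (simp add: zero_on_zero_coord)
    qed simp
    also have "\<dots> = (\<Sum>S\<in>Pow (insert a A). (-1) ^ card S * g (zero_on S u))"
      using insert by (simp add: sum_Pow_insert)
    finally show ?case .
  qed simp
  thus ?thesis by (simp add: all_coord_diff_def)
qed

text \<open>
  Pairing the set \<open>S\<close> with \<open>insert i S\<close> isolates the effect of a single coordinate. Choosing \<open>i\<close>
  with \<open>\<bar>u\<^sub>i\<bar>\<close> small is what makes the difference small.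
\<close>

lemma abs_all_coord_diff_le:
  fixes g :: "real ^ 'n \<Rightarrow> real"
  shows "\<bar>all_coord_diff g u\<bar> \<le> (\<Sum>S\<in>Pow (UNIV - {i}). \<bar>g (zero_on S u) - g (zero_on (insert i S) u)\<bar>)"
proof -
  have "all_coord_diff g u = (\<Sum>S\<in>Pow (insert i (UNIV - {i})). (-1) ^ card S * g (zero_on S u))"
    by (simp add: all_coord_diff_eq_sum insert_absorb)
  also have "\<dots> = (\<Sum>S\<in>Pow (UNIV - {i}). (-1) ^ card S * g (zero_on S u) + (-1) ^ card (insert i S) * g (zero_on (insert i S) u))"
    by (rule sum_Pow_insert) auto
  also have "\<bar>\<dots>\<bar> \<le> (\<Sum>S\<in>Pow (UNIV - {i}). \<bar>(-1) ^ card S * g (zero_on S u) + (-1) ^ card (insert i S) * g (zero_on (insert i S) u)\<bar>)"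
    by (rule sum_abs)
  also have "\<dots> = (\<Sum>S\<in>Pow (UNIV - {i}). \<bar>g (zero_on S u) - g (zero_on (insert i S) u)\<bar>)"
  proof (rule sum.cong)
    fix S assume "S \<in> Pow (UNIV - {i})"
    hence "card (insert i S) = Suc (card S)"
      by (intro card_insert_disjoint) auto
    hence "(-1) ^ card S * g (zero_on S u) + (-1) ^ card (insert i S) * g (zero_on (insert i S) u) =
        (-1) ^ card S * (g (zero_on S u) - g (zero_on (insert i S) u))"
      by (simp add: algebra_simps)
    thus "\<bar>(-1) ^ card S * g (zero_on S u) + (-1) ^ card (insert i S) * g (zero_on (insert i S) u)\<bar> =
        \<bar>g (zero_on S u) - g (zero_on (insert i S) u)\<bar>"
      by (simp add: abs_mult power_abs)
  qed simp
  finally show ?thesis .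
qed

lemma measurable_all_coord_diff [measurable]:
  fixes g :: "real ^ 'n \<Rightarrow> real"
  assumes [measurable]: "g \<in> borel_measurable borel"
  shows "all_coord_diff g \<in> borel_measurable borel"
  unfolding all_coord_diff_eq_sum[abs_def] by measurable

definition weight :: "('n \<Rightarrow> real) \<Rightarrow> real ^ 'n \<Rightarrow> real" where
  "weight lam u = (\<Prod>i\<in>UNIV. \<bar>u $ i\<bar> powr (- lam i - 1))"

lemma weight_nonneg [simp]: "0 \<le> weight lam u"
  by (simp add: weight_def prod_nonneg)

lemma measurable_weight [measurable]: "weight lam \<in> borel_measurable borel"
  unfolding weight_def[abs_def] by measurable

lemma weight_scaleR:
  fixes u :: "real ^ 'n"
  assumes "0 < s"
  shows "s ^ CARD('n) * weight lam (s *\<^sub>R u) = s powr - (\<Sum>i\<in>UNIV. lam i) * weight lam u"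
proof -
  have "(\<Prod>i\<in>UNIV. s powr (- lam i - 1)) = s powr (\<Sum>i\<in>UNIV. - lam i - 1)"
    using assms by (simp add: powr_sum)
  also have "\<dots> = s powr - (\<Sum>i\<in>UNIV. lam i) / s ^ CARD('n)"
    using assms by (simp add: sum_subtractf sum_negf powr_diff powr_realpow)
  finally show ?thesis using assms
    by (simp add: weight_def abs_mult powr_mult prod.distrib)
qed

lemma lborel_scaleR:
  assumes "0 < (s::real)"
  shows "(lborel :: (real ^ 'n) measure) = density (distr lborel borel (\<lambda>x. s *\<^sub>R x)) (\<lambda>_. ennreal (s ^ CARD('n)))"
  using lborel_affine[of s "0 :: real ^ 'n"] assms by (simp add: ennreal_power)

text \<open>
  The weight has degree \<open>- d - \<Sum>\<^sub>i lam\<^sub>i\<close>, and \<open>du\<close> contributes the power \<open>d\<close>.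
\<close>

lemma nn_integral_weight_scaleR:
  fixes f :: "real ^ 'n \<Rightarrow> ennreal"
  assumes [measurable]: "f \<in> borel_measurable borel" and s: "0 < s"
  shows "(\<integral>\<^sup>+u. ennreal (weight lam u) * f (s *\<^sub>R u) \<partial>lborel) =
    ennreal (s powr (\<Sum>i\<in>UNIV. lam i)) * (\<integral>\<^sup>+u. ennreal (weight lam u) * f u \<partial>lborel)"
proof -
  let ?L = "\<Sum>i\<in>UNIV. lam i"
  have "(\<integral>\<^sup>+u. ennreal (weight lam u) * f u \<partial>lborel) =
      (\<integral>\<^sup>+u. ennreal (s ^ CARD('n)) * (ennreal (weight lam (s *\<^sub>R u)) * f (s *\<^sub>R u)) \<partial>lborel)"
    using s by (subst lborel_scaleR[OF s]) (simp add: nn_integral_density nn_integral_distr)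
  also have "\<dots> = (\<integral>\<^sup>+u. ennreal (s powr - ?L) * (ennreal (weight lam u) * f (s *\<^sub>R u)) \<partial>lborel)"
    using s weight_scaleR[OF s, of lam]
    by (simp add: mult.assoc[symmetric] ennreal_mult'[symmetric])
  also have "\<dots> = ennreal (s powr - ?L) * (\<integral>\<^sup>+u. ennreal (weight lam u) * f (s *\<^sub>R u) \<partial>lborel)"
    by (rule nn_integral_cmult) measurable
  finally show ?thesis using s
    by (simp add: mult.assoc[symmetric] ennreal_mult'[symmetric] powr_add[symmetric])
qed

lemma integral_weight_scaleR:
  fixes f :: "real ^ 'n \<Rightarrow> real"
  assumes [measurable]: "f \<in> borel_measurable borel" and s: "0 < s"
  shows "(\<integral>u. weight lam u * f (s *\<^sub>R u) \<partial>lborel) =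
    s powr (\<Sum>i\<in>UNIV. lam i) * (\<integral>u. weight lam u * f u \<partial>lborel)"
proof -
  let ?L = "\<Sum>i\<in>UNIV. lam i"
  have "(\<integral>u. weight lam u * f u \<partial>lborel) =
      (\<integral>u. s ^ CARD('n) * weight lam (s *\<^sub>R u) * f (s *\<^sub>R u) \<partial>lborel)"
    using s by (subst lborel_scaleR[OF s]) (simp add: integral_density integral_distr mult.assoc)
  also have "\<dots> = s powr - ?L * (\<integral>u. weight lam u * f (s *\<^sub>R u) \<partial>lborel)"
    using s by (simp add: weight_scaleR mult.assoc)
  finally show ?thesis using s
    by (simp add: mult.assoc[symmetric] powr_add[symmetric])
qed

definition flip_signs :: "'n set \<Rightarrow> real ^ 'n \<Rightarrow> real ^ 'n" where
  "flip_signs S u = (\<chi> i. if i \<in> S then - u $ i else u $ i)"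

lemma norm_flip_signs [simp]: "norm (flip_signs S u) = norm (u :: real ^ 'n)"
  by (simp add: norm_eq_sqrt_inner inner_vec_def flip_signs_def if_distrib cong: if_cong)

lemma weight_flip_signs [simp]: "weight lam (flip_signs S u) = weight lam u"
  unfolding weight_def by (intro prod.cong) (auto simp: flip_signs_def)

lemma flip_signs_in_off_hyperplanes [simp]:
  "flip_signs S u \<in> off_hyperplanes \<epsilon> \<longleftrightarrow> (u :: real ^ 'n) \<in> off_hyperplanes \<epsilon>"
proof -
  have "\<bar>flip_signs S u $ i\<bar> = \<bar>u $ i\<bar>" for i by (simp add: flip_signs_def)
  thus ?thesis by (simp add: off_hyperplanes_def)
qed

lemma measurable_flip_signs [measurable]: "flip_signs S \<in> borel \<rightarrow>\<^sub>M (borel :: (real ^ 'n) measure)"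
proof (intro borel_measurable_continuous_onI, unfold flip_signs_def, intro continuous_on_vec_lambda)
  show "continuous_on UNIV (\<lambda>x :: real ^ 'n. if i \<in> S then - x $ i else x $ i)" for i
    by (cases "i \<in> S") (auto intro!: continuous_intros)
qed

text \<open>
  A sign change is a diagonal linear map with entries \<open>1\<close> and \<open>-1\<close>.
\<close>

lemma lborel_distr_flip_signs: "distr lborel borel (flip_signs S) = (lborel :: (real ^ 'n) measure)"
proof -
  let ?b = "\<lambda>i. axis i 1 :: real ^ 'n"
  have inj: "inj ?b" by (auto simp: inj_on_def axis_eq_axis)
  have Basis: "Basis = range ?b" by (auto simp: Basis_vec_def)
  define c :: "real ^ 'n \<Rightarrow> real" where "c b = (if b \<in> ?b ` S then -1 else 1)" for b
  have c_axis: "c (?b i) = (if i \<in> S then -1 else 1)" for i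
    by (simp add: c_def inj_image_mem_iff[OF inj])
  have "(\<lambda>x. 0 + (\<Sum>j\<in>Basis. (c j * (x \<bullet> j)) *\<^sub>R j)) = flip_signs S"
  proof (rule ext)
    fix x
    have "(\<Sum>j\<in>Basis. (c j * (x \<bullet> j)) *\<^sub>R j) = (\<Sum>i\<in>UNIV. (c (?b i) * x $ i) *\<^sub>R ?b i)"
      by (simp add: Basis sum.reindex[OF inj] inner_axis)
    also have "\<dots> = flip_signs S x"
    proof (subst vec_eq_iff, intro allI)
      fix k
      have "(\<Sum>i\<in>UNIV. (c (?b i) * x $ i) *\<^sub>R ?b i) $ k = (\<Sum>i\<in>UNIV. if i = k then c (?b i) * x $ i else 0)"
        unfolding sum_component by (intro sum.cong) (auto simp: axis_def)
      thus "(\<Sum>i\<in>UNIV. (c (?b i) * x $ i) *\<^sub>R ?b i) $ k = flip_signs S x $ k"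
        by (simp add: c_axis flip_signs_def)
    qed
    finally show "0 + (\<Sum>j\<in>Basis. (c j * (x \<bullet> j)) *\<^sub>R j) = flip_signs S x" by simp
  qed
  moreover have "(\<Prod>j\<in>Basis. \<bar>c j\<bar>) = 1"
    by (intro prod.neutral) (auto simp: c_def)
  ultimately show ?thesis
    using lborel_affine_euclidean[of c 0] by (simp add: c_def density_1)
qed

lemma integral_lborel_flip_signs:
  fixes f :: "real ^ 'n \<Rightarrow> real"
  assumes [measurable]: "f \<in> borel_measurable borel"
  shows "(\<integral>u. f (flip_signs S u) \<partial>lborel) = (\<integral>u. f u \<partial>lborel)"
  using integral_distr[of "flip_signs S" "lborel :: (real ^ 'n) measure" borel f]
  by (simp add: lborel_distr_flip_signs)

section \<open>The gauge as a fractional moment\<close>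

lemma powr_add_le:
  fixes x y :: real
  assumes "0 \<le> x" "0 \<le> y" "0 < p" "p \<le> 1"
  shows "(x + y) powr p \<le> x powr p + y powr p"
proof (cases "x + y = 0")
  case False
  hence s: "x + y > 0" using assms by simp
  have *: "z / (x + y) \<le> (z / (x + y)) powr p" if "0 \<le> z" "z \<le> x + y" for z
    using powr_mono'[of p 1 "z / (x + y)"] assms that s by simp
  have "1 = x / (x + y) + y / (x + y)" using s by (simp add: add_divide_distrib[symmetric])
  also have "\<dots> \<le> (x / (x + y)) powr p + (y / (x + y)) powr p"
    using assms by (intro add_mono *) auto
  also have "\<dots> = (x powr p + y powr p) / (x + y) powr p"
    using assms by (simp add: powr_divide add_divide_distrib)
  finally show ?thesis using s by (simp add: field_simps)
qed (use assms in simp)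

lemma abs_powr_triangle:
  fixes x y :: real
  assumes "0 < p" "p \<le> 1"
  shows "\<bar>x\<bar> powr p \<le> \<bar>y\<bar> powr p + \<bar>x - y\<bar> powr p"
proof -
  have "\<bar>x\<bar> powr p \<le> (\<bar>y\<bar> + \<bar>x - y\<bar>) powr p"
    using assms by (intro powr_mono2) auto
  also have "\<dots> \<le> \<bar>y\<bar> powr p + \<bar>x - y\<bar> powr p"
    using assms by (intro powr_add_le) auto
  finally show ?thesis .
qed

text \<open>
  Here \<open>N\<close> stands for the gauge of the star body. The characteristic function is real, so its cosine
  part carries the whole relation between \<open>\<xi>\<close> and \<open>N\<close>.
\<close>

locale stable_vector = prob_space M for M :: "'a measure" +
  fixes \<xi> :: "'a \<Rightarrow> real ^ 'n" and \<alpha> :: real and N :: "real ^ 'n \<Rightarrow> real"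
  assumes measurable_xi [measurable]: "\<xi> \<in> borel_measurable M"
    and \<alpha>: "0 < \<alpha>" "\<alpha> \<le> 2"
    and N_nonneg [simp]: "\<And>u. 0 \<le> N u"
    and N_scaleR: "\<And>c u. N (c *\<^sub>R u) = \<bar>c\<bar> * N u"
    and char_xi: "\<And>u. expectation (\<lambda>\<omega>. cos (\<xi> \<omega> \<bullet> u)) = exp (- (N u powr \<alpha>))"
begin

text \<open>The factor between \<open>N v powr p\<close> and the \<open>p\<close>-th absolute moment of \<open>\<langle>\<xi>, v\<rangle>\<close>.\<close>

definition proj_const :: "real \<Rightarrow> real" where
  "proj_const p = 2 / p * Gamma (1 - p / \<alpha>) / cos_kernel_const p"

lemma proj_const_pos:
  assumes "0 < p" "p < \<alpha>"
  shows "0 < proj_const p"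
  using assms \<alpha> by (simp add: proj_const_def cos_kernel_const_pos)

text \<open>
  The projection \<open>\<langle>\<xi>, v\<rangle>\<close> is a symmetric stable variable with scale \<open>N v\<close>.
\<close>

lemma nn_integral_abs_inner_powr:
  assumes p: "0 < p" "p < \<alpha>"
  shows "(\<integral>\<^sup>+\<omega>. ennreal (\<bar>\<xi> \<omega> \<bullet> v\<bar> powr p) \<partial>M) = ennreal (proj_const p * N v powr p)"
  unfolding proj_const_def
proof (rule nn_integral_abs_powr_of_char)
  show "expectation (\<lambda>\<omega>. cos (t * (\<xi> \<omega> \<bullet> v))) = exp (- ((\<bar>t\<bar> * N v) powr \<alpha>))" for t
    using char_xi[of "t *\<^sub>R v"] by (simp add: N_scaleR)
qed (use p \<alpha> in auto)

lemma
  assumes p: "0 < p" "p < \<alpha>"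
  shows integrable_abs_inner_powr: "integrable M (\<lambda>\<omega>. \<bar>\<xi> \<omega> \<bullet> v\<bar> powr p)"
    and expectation_abs_inner_powr: "expectation (\<lambda>\<omega>. \<bar>\<xi> \<omega> \<bullet> v\<bar> powr p) = proj_const p * N v powr p"
proof -
  have "has_bochner_integral M (\<lambda>\<omega>. \<bar>\<xi> \<omega> \<bullet> v\<bar> powr p) (proj_const p * N v powr p)"
    using nn_integral_abs_inner_powr[OF p] proj_const_pos[OF p]
    by (intro has_bochner_integral_nn_integral) auto
  thus "integrable M (\<lambda>\<omega>. \<bar>\<xi> \<omega> \<bullet> v\<bar> powr p)" "expectation (\<lambda>\<omega>. \<bar>\<xi> \<omega> \<bullet> v\<bar> powr p) = proj_const p * N v powr p"
    by (auto simp: has_bochner_integral_iff)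
qed

lemma measurable_N [measurable]: "N \<in> borel_measurable borel"
proof -
  have "N = (\<lambda>v. (- ln (expectation (\<lambda>\<omega>. cos (\<xi> \<omega> \<bullet> v)))) powr (1 / \<alpha>))"
    using \<alpha> by (simp add: char_xi powr_powr)
  also have "\<dots> \<in> borel_measurable borel" by measurable
  finally show ?thesis .
qed

text \<open>
  \<open>N v powr p\<close> is a multiple of \<open>\<bold>E \<bar>\<langle>\<xi>, v\<rangle>\<bar> powr p\<close>, and \<open>\<bar>x\<bar> powr p\<close> is subadditive for \<open>p \<le> 1\<close>. This
  treats \<open>\<alpha> < 1\<close> and \<open>\<alpha> \<ge> 1\<close> alike, although \<open>N\<close> itself is in general subadditive only in the second case.
\<close>

lemma N_powr_triangle:
  assumes p: "0 < p" "p < \<alpha>" "p \<le> 1"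
  shows "N v powr p \<le> N w powr p + N (v - w) powr p"
proof -
  have "proj_const p * N v powr p \<le> proj_const p * N w powr p + proj_const p * N (v - w) powr p"
    unfolding expectation_abs_inner_powr[OF p(1,2), symmetric]
      Bochner_Integration.integral_add[OF integrable_abs_inner_powr integrable_abs_inner_powr, OF p(1,2) p(1,2), symmetric]
    using abs_powr_triangle[OF p(1,3)]
    by (intro integral_mono Bochner_Integration.integrable_add integrable_abs_inner_powr p)
      (auto simp: inner_diff_right)
  thus ?thesis using proj_const_pos[OF p(1,2)]
    by (simp add: distrib_left[symmetric])
qed

lemma abs_N_powr_diff_le:
  assumes p: "0 < p" "p < \<alpha>" "p \<le> 1"
  shows "\<bar>N v powr p - N w powr p\<bar> \<le> N (v - w) powr p"
proof -
  have "N (w - v) = N (v - w)" using N_scaleR[of "-1" "v - w"] by simp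
  thus ?thesis using N_powr_triangle[OF p, of v w] N_powr_triangle[OF p, of w v] by simp
qed

lemma N_zero [simp]: "N 0 = 0"
  using N_scaleR[of 0 0] by simp

lemma N_powr_sum_le:
  assumes p: "0 < p" "p < \<alpha>" "p \<le> 1" and "finite A"
  shows "N (\<Sum>i\<in>A. f i) powr p \<le> (\<Sum>i\<in>A. N (f i) powr p)"
  using assms(4)
proof (induction A rule: finite_induct)
  case (insert a A)
  thus ?case using N_powr_triangle[OF p, of "f a + (\<Sum>i\<in>A. f i)" "f a"] by simp
qed simp

text \<open>
  Subadditivity along the coordinate expansion of \<open>u\<close> bounds \<open>N u powr p\<close> by a multiple of
  \<open>norm u powr p\<close>. Hence \<open>F\<close> contains a ball around the origin.
\<close>

lemma N_le_one_near_zero: "\<exists>\<rho>>0. \<forall>u. norm u \<le> \<rho> \<longrightarrow> N u \<le> 1"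
proof -
  \<comment> \<open>Any exponent \<open>p < \<alpha>\<close> with \<open>p \<le> 1\<close> would do.\<close>
  define p where "p = \<alpha> / 2"
  have p: "0 < p" "p < \<alpha>" "p \<le> 1" using \<alpha> by (auto simp: p_def)
  define C where "C = (\<Sum>i\<in>UNIV. N (axis i 1) powr p)"
  have C: "0 \<le> C" by (auto simp: C_def intro: sum_nonneg)
  have bound: "N u powr p \<le> norm u powr p * C" for u
  proof -
    have "N u powr p = N (\<Sum>i\<in>UNIV. (u $ i) *\<^sub>R axis i 1) powr p"
      using basis_expansion[of u] by (simp add: scalar_mult_eq_scaleR)
    also have "\<dots> \<le> (\<Sum>i\<in>UNIV. N ((u $ i) *\<^sub>R axis i 1) powr p)"
      by (rule N_powr_sum_le[OF p]) simp
    also have "\<dots> \<le> (\<Sum>i\<in>UNIV. norm u powr p * N (axis i 1) powr p)"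
      using p component_le_norm_cart[of u]
      by (intro sum_mono) (auto simp: N_scaleR powr_mult intro!: mult_right_mono powr_mono2)
    finally show ?thesis by (simp add: C_def sum_distrib_left)
  qed
  define \<rho> where "\<rho> = (1 / (C + 1)) powr (1 / p)"
  have "\<rho> > 0" using C by (simp add: \<rho>_def)
  moreover have "N u \<le> 1" if "norm u \<le> \<rho>" for u
  proof -
    have "N u powr p \<le> norm u powr p * C" by (rule bound)
    also have "\<dots> \<le> \<rho> powr p * C"
      using that p C by (intro mult_right_mono powr_mono2) auto
    also have "\<rho> powr p = 1 / (C + 1)" using p C by (simp add: \<rho>_def powr_powr)
    also have "1 / (C + 1) * C \<le> 1" using C by (simp add: field_simps)
    finally have "N u powr p \<le> 1 powr p" by simp
    thus "N u \<le> 1" using p by (smt (verit) powr_less_mono2)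
  qed
  ultimately show ?thesis by blast
qed

end

section \<open>The moment as a principal value\<close>

text \<open>
  Each coordinate in turn contributes \<open>cos (c + y) + cos (c - y) = 2 * cos c * cos y\<close>; the shift \<open>c\<close>
  absorbs the coordinates that have already been treated.
\<close>

lemma sum_signs_cos:
  fixes y :: "'b \<Rightarrow> real"
  assumes "finite A"
  shows "(\<Sum>S\<in>Pow A. cos (c + (\<Sum>i\<in>A. if i \<in> S then - y i else y i))) = cos c * (\<Prod>i\<in>A. 2 * cos (y i))"
  using assms
proof (induction A arbitrary: c rule: finite_induct)
  case (insert a A)
  let ?s = "\<lambda>S. \<Sum>i\<in>A. if i \<in> S then - y i else y i"
  have "(\<Sum>S\<in>Pow (insert a A). cos (c + (\<Sum>i\<in>insert a A. if i \<in> S then - y i else y i))) =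
      (\<Sum>S\<in>Pow A. cos ((c + y a) + ?s S) + cos ((c - y a) + ?s S))"
  proof (subst sum_Pow_insert[OF insert.hyps], rule sum.cong)
    fix S assume "S \<in> Pow A"
    hence "a \<notin> S" using insert.hyps by auto
    moreover have "?s (insert a S) = ?s S"
      using insert.hyps by (intro sum.cong) auto
    ultimately show "cos (c + (\<Sum>i\<in>insert a A. if i \<in> S then - y i else y i)) +
        cos (c + (\<Sum>i\<in>insert a A. if i \<in> insert a S then - y i else y i)) =
        cos ((c + y a) + ?s S) + cos ((c - y a) + ?s S)"
      using insert.hyps by (simp add: algebra_simps)
  qed simp
  also have "\<dots> = (cos (c + y a) + cos (c - y a)) * (\<Prod>i\<in>A. 2 * cos (y i))"
    by (simp add: sum.distrib insert.IH distrib_right)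
  also have "cos (c + y a) + cos (c - y a) = cos c * (2 * cos (y a))"
    by (simp add: cos_add cos_diff)
  finally show ?case using insert.hyps by simp
qed simp

text \<open>
  The sum over sign changes factorises the cosine of a sum, a coordinate in \<open>T\<close> giving the factor
  \<open>cos 0 = 1\<close>. The alternating sum over \<open>T\<close> is then the expansion of \<open>\<Prod>\<^sub>i (cos (u\<^sub>i x\<^sub>i) - 1)\<close>.
\<close>

lemma alternating_sum_signs_cos:
  fixes x u :: "real ^ 'n"
  shows "(\<Sum>S\<in>Pow UNIV. \<Sum>T\<in>Pow UNIV. (-1) ^ card T * cos (x \<bullet> zero_on T (flip_signs S u))) =
    (-2) ^ CARD('n) * (\<Prod>i\<in>UNIV. 1 - cos (u $ i * x $ i))"
proof -
  have "(\<Sum>S\<in>Pow UNIV. cos (x \<bullet> zero_on T (flip_signs S u))) =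
      2 ^ CARD('n) * (\<Prod>i\<in>UNIV - T. cos (u $ i * x $ i))" for T
  proof -
    define y where "y i = (if i \<in> T then 0 else u $ i * x $ i)" for i
    have "x \<bullet> zero_on T (flip_signs S u) = 0 + (\<Sum>i\<in>UNIV. if i \<in> S then - y i else y i)" for S
      by (auto simp: inner_vec_def zero_on_def flip_signs_def y_def intro!: sum.cong)
    hence "(\<Sum>S\<in>Pow UNIV. cos (x \<bullet> zero_on T (flip_signs S u))) = cos 0 * (\<Prod>i\<in>UNIV. 2 * cos (y i))"
      by (simp only: sum_signs_cos[OF finite])
    also have "\<dots> = 2 ^ CARD('n) * (\<Prod>i\<in>UNIV. cos (y i))"
      by (simp add: prod.distrib)
    also have "(\<Prod>i\<in>UNIV. cos (y i)) = (\<Prod>i\<in>UNIV - T. cos (u $ i * x $ i))"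
      by (rule prod.mono_neutral_cong_right) (auto simp: y_def)
    finally show ?thesis .
  qed
  hence "(\<Sum>T\<in>Pow UNIV. \<Sum>S\<in>Pow UNIV. (-1) ^ card T * cos (x \<bullet> zero_on T (flip_signs S u))) =
      2 ^ CARD('n) * (\<Sum>T\<in>Pow UNIV. (\<Prod>i\<in>T. - 1) * (\<Prod>i\<in>UNIV - T. cos (u $ i * x $ i)))"
    by (simp add: sum_distrib_left[symmetric] sum_distrib_left mult_ac)
  also have "\<dots> = 2 ^ CARD('n) * (\<Prod>i\<in>UNIV. - 1 + cos (u $ i * x $ i))"
    by (subst prod_add) auto
  also have "(\<Prod>i\<in>UNIV. - 1 + cos (u $ i * x $ i)) = (\<Prod>i\<in>UNIV. (- 1) * (1 - cos (u $ i * x $ i)))"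
    by (intro prod.cong) auto
  also have "\<dots> = (- 1) ^ CARD('n) * (\<Prod>i\<in>UNIV. 1 - cos (u $ i * x $ i))"
    by (subst prod.distrib) simp
  finally show ?thesis
    by (subst sum.swap) (simp add: mult.assoc[symmetric] power_mult_distrib[symmetric])
qed

lemma ex_max_coord: "\<exists>k. \<forall>i. \<bar>x $ i\<bar> \<le> \<bar>x $ k\<bar>" for x :: "real ^ 'n"
proof -
  have "Max (range (\<lambda>i. \<bar>x $ i\<bar>)) \<in> range (\<lambda>i. \<bar>x $ i\<bar>)" by (intro Max_in) auto
  then obtain k where k: "Max (range (\<lambda>i. \<bar>x $ i\<bar>)) = \<bar>x $ k\<bar>" by (rule imageE)
  have "\<bar>x $ i\<bar> \<le> \<bar>x $ k\<bar>" for i unfolding k[symmetric] by (intro Max_ge) auto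
  thus ?thesis by blast
qed

text \<open>
  All coordinates are at most the one of largest modulus, whose power is one of the summands.
\<close>

lemma prod_powr_le_sum_powr:
  fixes x :: "real ^ 'n"
  assumes lam: "\<And>i. 0 < lam i"
  shows "(\<Prod>i\<in>UNIV. \<bar>x $ i\<bar> powr lam i) \<le> (\<Sum>i\<in>UNIV. \<bar>x $ i\<bar> powr (\<Sum>j\<in>UNIV. lam j))"
proof -
  obtain k where k: "\<And>i. \<bar>x $ i\<bar> \<le> \<bar>x $ k\<bar>" using ex_max_coord[of x] by blast
  have "(\<Prod>i\<in>UNIV. \<bar>x $ i\<bar> powr lam i) \<le> (\<Prod>i\<in>UNIV. \<bar>x $ k\<bar> powr lam i)"
    using lam k by (intro prod_mono conjI powr_mono2) (auto simp: less_imp_le)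
  also have "\<dots> \<le> \<bar>x $ k\<bar> powr (\<Sum>j\<in>UNIV. lam j)"
  proof (cases "x $ k = 0")
    case False
    thus ?thesis by (simp add: powr_sum)
  qed (simp add: power_0_left)
  also have "\<dots> \<le> (\<Sum>i\<in>UNIV. \<bar>x $ i\<bar> powr (\<Sum>j\<in>UNIV. lam j))"
    by (rule member_le_sum) auto
  finally show ?thesis .
qed

lemma off_hyperplanes_scaleR:
  assumes "0 < s"
  shows "s *\<^sub>R u \<in> off_hyperplanes \<epsilon> \<longleftrightarrow> u \<in> (off_hyperplanes \<epsilon> :: (real ^ 'n) set)"
  using assms by (simp add: off_hyperplanes_def abs_mult mult.left_commute)

locale stable_moment = stable_vector M \<xi> \<alpha> N
  for M :: "'a measure" and \<xi> :: "'a \<Rightarrow> real ^ 'n" and \<alpha> N +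
  fixes lam :: "'n \<Rightarrow> real"
  assumes lam_pos: "\<And>i. 0 < lam i"
    and sum_lam_less: "(\<Sum>i\<in>UNIV. lam i) < \<alpha>"
begin

abbreviation L :: real where "L \<equiv> \<Sum>i\<in>UNIV. lam i"

lemma lam_le_L: "lam i \<le> L"
  using lam_pos by (intro member_le_sum) (auto intro: less_imp_le)

lemma L_pos: "0 < L"
  using lam_pos lam_le_L less_le_trans by blast

lemma lam_less_2: "lam i < 2"
  using lam_le_L[of i] sum_lam_less \<alpha> by simp

lemma Gamma_pos: "0 < Gamma (1 - L / \<alpha>)"
  using sum_lam_less \<alpha> by simp

definition moment :: real where
  "moment = expectation (\<lambda>\<omega>. \<Prod>i\<in>UNIV. \<bar>\<xi> \<omega> $ i\<bar> powr lam i)"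

text \<open>
  Bounding the product by powers of single coordinates reduces the claim to the fractional moments
  of order \<open>L < \<alpha>\<close> of the coordinates.
\<close>

lemma integrable_moment: "integrable M (\<lambda>\<omega>. \<Prod>i\<in>UNIV. \<bar>\<xi> \<omega> $ i\<bar> powr lam i)"
proof (rule Bochner_Integration.integrable_bound)
  show "integrable M (\<lambda>\<omega>. \<Sum>i\<in>UNIV. \<bar>\<xi> \<omega> \<bullet> axis i 1\<bar> powr L)"
    by (intro Bochner_Integration.integrable_sum integrable_abs_inner_powr L_pos sum_lam_less)
  show "AE \<omega> in M. norm (\<Prod>i\<in>UNIV. \<bar>\<xi> \<omega> $ i\<bar> powr lam i) \<le> norm (\<Sum>i\<in>UNIV. \<bar>\<xi> \<omega> \<bullet> axis i 1\<bar> powr L)"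
    using prod_powr_le_sum_powr[of lam, OF lam_pos]
    by (intro AE_I2) (auto simp: inner_axis abs_prod prod_nonneg intro: order_trans[OF _ abs_ge_self])
qed measurable

definition cos_prod :: "real ^ 'n \<Rightarrow> real" where
  "cos_prod u = expectation (\<lambda>\<omega>. \<Prod>i\<in>UNIV. 1 - cos (u $ i * \<xi> \<omega> $ i))"

lemma measurable_cos_prod [measurable]: "cos_prod \<in> borel_measurable borel"
  unfolding cos_prod_def[abs_def] by measurable

lemma integrable_prod_one_minus_cos: "integrable M (\<lambda>\<omega>. \<Prod>i\<in>UNIV. 1 - cos (u $ i * \<xi> \<omega> $ i))"
proof (rule integrable_const_bound[where B = "2 ^ CARD('n)"])
  have "(\<Prod>i\<in>UNIV. \<bar>1 - cos (u $ i * \<xi> \<omega> $ i)\<bar>) \<le> (\<Prod>i\<in>(UNIV :: 'n set). 2)" for \<omega>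
    by (intro prod_mono) (auto simp: abs_le_iff)
  thus "AE \<omega> in M. norm (\<Prod>i\<in>UNIV. 1 - cos (u $ i * \<xi> \<omega> $ i)) \<le> 2 ^ CARD('n)"
    by (simp add: abs_prod)
qed measurable

lemma cos_prod_nonneg: "0 \<le> cos_prod u"
  unfolding cos_prod_def by (intro Bochner_Integration.integral_nonneg prod_nonneg) auto

text \<open>
  For fixed \<open>\<omega>\<close> the integrand is a product of functions of one coordinate each, so the integral over
  \<open>u\<close> is a product of the one-dimensional cosine integrals. Nonnegativity lets it be exchanged with
  the expectation.
\<close>

lemma has_bochner_integral_weight_cos_prod:
  "has_bochner_integral lborel (\<lambda>u. weight lam u * cos_prod u) ((\<Prod>i\<in>UNIV. cos_kernel_const (lam i)) * moment)"
proof (rule has_bochner_integral_nn_integral)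
  interpret pair_sigma_finite M "lborel :: (real ^ 'n) measure" by unfold_locales
  have K: "0 < cos_kernel_const (lam i)" for i
    using lam_pos lam_less_2 by (intro cos_kernel_const_pos) auto
  show nonneg: "0 \<le> (\<Prod>i\<in>UNIV. cos_kernel_const (lam i)) * moment"
    unfolding moment_def using K
    by (intro mult_nonneg_nonneg prod_nonneg Bochner_Integration.integral_nonneg) (auto intro: less_imp_le)
  have "(\<integral>\<^sup>+u. ennreal (weight lam u * cos_prod u) \<partial>lborel) =
      (\<integral>\<^sup>+u. \<integral>\<^sup>+\<omega>. ennreal (weight lam u * (\<Prod>i\<in>UNIV. 1 - cos (u $ i * \<xi> \<omega> $ i))) \<partial>M \<partial>lborel)"
    using integrable_prod_one_minus_cos
    by (intro nn_integral_cong, subst nn_integral_eq_integral)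
      (auto simp: cos_prod_def intro!: mult_nonneg_nonneg prod_nonneg)
  also have "\<dots> = (\<integral>\<^sup>+\<omega>. \<integral>\<^sup>+u. ennreal (weight lam u * (\<Prod>i\<in>UNIV. 1 - cos (u $ i * \<xi> \<omega> $ i))) \<partial>lborel \<partial>M)"
    by (rule Fubini') measurable
  also have "\<dots> = (\<integral>\<^sup>+\<omega>. ennreal ((\<Prod>i\<in>UNIV. cos_kernel_const (lam i)) * (\<Prod>i\<in>UNIV. \<bar>\<xi> \<omega> $ i\<bar> powr lam i)) \<partial>M)"
  proof (intro nn_integral_cong)
    fix \<omega>
    have "(\<integral>\<^sup>+u. ennreal (weight lam u * (\<Prod>i\<in>UNIV. 1 - cos (u $ i * \<xi> \<omega> $ i))) \<partial>lborel) =
      (\<integral>\<^sup>+u. (\<Prod>i\<in>UNIV. ennreal (\<bar>u $ i\<bar> powr (- lam i - 1) * (1 - cos (u $ i * \<xi> \<omega> $ i)))) \<partial>lborel)"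
      by (simp add: weight_def prod.distrib[symmetric] prod_ennreal)
    also have "\<dots> = (\<Prod>i\<in>UNIV. \<integral>\<^sup>+t. ennreal (\<bar>t\<bar> powr (- lam i - 1) * (1 - cos (t * \<xi> \<omega> $ i))) \<partial>lborel)"
      by (rule nn_integral_lborel_vec_prod) auto
    also have "\<dots> = (\<Prod>i\<in>UNIV. ennreal (\<bar>\<xi> \<omega> $ i\<bar> powr lam i * cos_kernel_const (lam i)))"
      using lam_pos lam_less_2 K
      by (simp add: nn_integral_cos_kernel_scale nn_integral_cos_kernel ennreal_mult'[symmetric])
    also have "\<dots> = ennreal ((\<Prod>i\<in>UNIV. cos_kernel_const (lam i)) * (\<Prod>i\<in>UNIV. \<bar>\<xi> \<omega> $ i\<bar> powr lam i))"
      using K by (subst prod_ennreal) (auto simp: prod.distrib mult.commute intro!: mult_nonneg_nonneg less_imp_le[OF K])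
    finally show "(\<integral>\<^sup>+u. ennreal (weight lam u * (\<Prod>i\<in>UNIV. 1 - cos (u $ i * \<xi> \<omega> $ i))) \<partial>lborel) =
      ennreal ((\<Prod>i\<in>UNIV. cos_kernel_const (lam i)) * (\<Prod>i\<in>UNIV. \<bar>\<xi> \<omega> $ i\<bar> powr lam i))" .
  qed
  also have "\<dots> = ennreal ((\<Prod>i\<in>UNIV. cos_kernel_const (lam i)) * moment)"
    using integrable_moment
    by (subst nn_integral_eq_integral)
      (auto simp: moment_def intro!: AE_I2 mult_nonneg_nonneg prod_nonneg less_imp_le[OF K])
  finally show "(\<integral>\<^sup>+u. ennreal (weight lam u * cos_prod u) \<partial>lborel) =
      ennreal ((\<Prod>i\<in>UNIV. cos_kernel_const (lam i)) * moment)" .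
qed (auto simp: cos_prod_nonneg)

definition char_fun :: "real ^ 'n \<Rightarrow> real" where
  "char_fun u = exp (- (N u powr \<alpha>))"

lemma measurable_char_fun [measurable]: "char_fun \<in> borel_measurable borel"
  unfolding char_fun_def[abs_def] by measurable

text \<open>
  Sign changes remove the terms of \<open>\<Prod>\<^sub>i (exp (\<i> u\<^sub>i \<xi>\<^sub>i) - 1)\<close> that are odd in some \<open>u\<^sub>i\<close>. Each of the \<open>d\<close>
  factors \<open>cos (u\<^sub>i \<xi>\<^sub>i) - 1\<close> contributes a sign, which together with the number \<open>2\<^sup>d\<close> of sign changes makes
  \<open>(-2)\<^sup>d\<close>.
\<close>

lemma sum_flip_signs_coord_diff_char_fun:
  "(\<Sum>S\<in>Pow UNIV. all_coord_diff char_fun (flip_signs S u)) = (-2) ^ CARD('n) * cos_prod u"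
proof -
  have int1: "integrable M (\<lambda>\<omega>. c * cos (\<xi> \<omega> \<bullet> v))" for c v
    by (intro integrable_mult_right integrable_const_bound[where B = 1]) auto
  have int2: "integrable M (\<lambda>\<omega>. \<Sum>T\<in>Pow UNIV. c T * cos (\<xi> \<omega> \<bullet> v T))" for c and v :: "'n set \<Rightarrow> _"
    by (rule Bochner_Integration.integrable_sum) (rule int1)
  have "(\<Sum>S\<in>Pow UNIV. all_coord_diff char_fun (flip_signs S u)) =
      expectation (\<lambda>\<omega>. \<Sum>S\<in>Pow UNIV. \<Sum>T\<in>Pow UNIV. (-1) ^ card T * cos (\<xi> \<omega> \<bullet> zero_on T (flip_signs S u)))"
    by (simp only: all_coord_diff_eq_sum char_fun_def char_xi[symmetric] Bochner_Integration.integral_sum int1 int2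
        integral_mult_right_zero)
  also have "\<dots> = (-2) ^ CARD('n) * cos_prod u"
    by (simp only: alternating_sum_signs_cos cos_prod_def integral_mult_right_zero)
  finally show ?thesis .
qed

definition body :: "(real ^ 'n) set" where "body = {u. N u \<le> 1}"

lemma measurable_body [measurable]: "body \<in> sets borel"
  unfolding body_def by measurable

abbreviation body_diff :: "real ^ 'n \<Rightarrow> real" where
  "body_diff \<equiv> all_coord_diff (indicator body)"

lemma indicator_body_scaleR:
  assumes "0 < r"
  shows "indicator body (r powr (- 1 / \<alpha>) *\<^sub>R v) = (indicator {N v powr \<alpha>..} r :: real)"
proof -
  have "N (r powr (- 1 / \<alpha>) *\<^sub>R v) \<le> 1 \<longleftrightarrow> N v \<le> r powr (1 / \<alpha>)"
    using assms by (simp add: N_scaleR powr_minus field_simps)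
  also have "\<dots> \<longleftrightarrow> N v powr \<alpha> \<le> (r powr (1 / \<alpha>)) powr \<alpha>"
    using \<alpha> by (smt (verit) N_nonneg powr_ge_zero powr_less_mono2 powr_mono2)
  also have "(r powr (1 / \<alpha>)) powr \<alpha> = r" using assms \<alpha> by (simp add: powr_powr)
  finally show ?thesis by (simp add: body_def indicator_def)
qed

text \<open>
  The dilate \<open>r powr (- 1 / \<alpha>) *\<^sub>R v\<close> lies in the body exactly if \<open>r \<ge> N v powr \<alpha>\<close>, so this is the tail
  integral of \<open>exp (- r)\<close>.
\<close>

lemma has_bochner_integral_char_fun:
  "has_bochner_integral lborel
    (\<lambda>r. indicator {0<..} r * exp (- r) * indicator body (r powr (- 1 / \<alpha>) *\<^sub>R v)) (char_fun v)"
proof (rule has_bochner_integral_nn_integral)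
  have "(\<integral>\<^sup>+r. ennreal (indicator {0<..} r * exp (- r) * indicator body (r powr (- 1 / \<alpha>) *\<^sub>R v)) \<partial>lborel) =
      (\<integral>\<^sup>+r. ennreal (exp (- r)) * indicator {N v powr \<alpha>..} r \<partial>lborel)"
  proof (rule nn_integral_cong_AE)
    have "AE r in lborel. r \<noteq> (0::real)" by (rule AE_lborel_singleton)
    thus "AE r in lborel. ennreal (indicator {0<..} r * exp (- r) * indicator body (r powr (- 1 / \<alpha>) *\<^sub>R v)) =
        ennreal (exp (- r)) * indicator {N v powr \<alpha>..} r"
    proof eventually_elim
      case (elim r)
      show ?case
      proof (cases "r > 0")
        case True
        show ?thesis using True by (simp only: indicator_body_scaleR[OF True]) (simp add: indicator_def)
      next
        case False
        hence "\<not> N v powr \<alpha> \<le> r" using elim by (smt (verit) powr_ge_zero)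
        thus ?thesis using False by (simp add: indicator_def)
      qed
    qed
  qed
  thus "(\<integral>\<^sup>+r. ennreal (indicator {0<..} r * exp (- r) * indicator body (r powr (- 1 / \<alpha>) *\<^sub>R v)) \<partial>lborel) =
      ennreal (char_fun v)"
    by (simp add: exp_eq_tail_integral char_fun_def)
qed (auto simp: char_fun_def)

lemma has_bochner_integral_coord_diff_char_fun:
  "has_bochner_integral lborel
    (\<lambda>r. indicator {0<..} r * exp (- r) * body_diff (r powr (- 1 / \<alpha>) *\<^sub>R u)) (all_coord_diff char_fun u)"
proof -
  have "has_bochner_integral lborel
    (\<lambda>r. \<Sum>S\<in>Pow UNIV. (-1) ^ card S * (indicator {0<..} r * exp (- r) *
      indicator body (r powr (- 1 / \<alpha>) *\<^sub>R zero_on S u))) (\<Sum>S\<in>Pow UNIV. (-1) ^ card S * char_fun (zero_on S u))"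
    by (intro has_bochner_integral_sum has_bochner_integral_mult_right has_bochner_integral_char_fun)
  also have "(\<lambda>r. \<Sum>S\<in>Pow UNIV. (-1) ^ card S * (indicator {0<..} r * exp (- r) *
      indicator body (r powr (- 1 / \<alpha>) *\<^sub>R zero_on S u))) =
    (\<lambda>r. indicator {0<..} r * exp (- r) * body_diff (r powr (- 1 / \<alpha>) *\<^sub>R u))"
    by (intro ext, unfold all_coord_diff_eq_sum zero_on_scaleR sum_distrib_left, intro sum.cong refl)
      (simp only: mult_ac)
  finally show ?thesis by (simp only: all_coord_diff_eq_sum[of char_fun])
qed

lemma abs_body_diff_le: "\<bar>body_diff u\<bar> \<le> 2 ^ CARD('n)"
proof -
  have "\<bar>body_diff u\<bar> \<le> (\<Sum>S\<in>Pow (UNIV::'n set). 1)"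
    unfolding all_coord_diff_eq_sum
    by (rule order_trans[OF sum_abs], intro sum_mono) (auto simp: abs_mult power_abs indicator_def)
  thus ?thesis by (simp add: card_Pow)
qed

lemma body_diff_eq_0_near_zero: "\<exists>\<rho>>0. \<forall>u. norm u \<le> \<rho> \<longrightarrow> body_diff u = 0"
proof -
  obtain \<rho> where \<rho>: "\<rho> > 0" "\<And>u. norm u \<le> \<rho> \<Longrightarrow> N u \<le> 1" using N_le_one_near_zero by blast
  have "body_diff u = 0" if "norm u \<le> \<rho>" for u
  proof -
    have "zero_on S u \<in> body" for S
      using \<rho>(2) that norm_zero_on_le[of S u] by (auto simp: body_def)
    thus ?thesis
      using abs_all_coord_diff_le[of "indicator body" u undefined] by simp
  qed
  thus ?thesis using \<rho>(1) by blast
qed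

text \<open>
  On the support of the integrand the norm exceeds some \<open>\<rho> > 0\<close>, since the difference vanishes near
  the origin. In the cone this forces every coordinate to exceed \<open>\<epsilon> * \<rho>\<close>, and the weight is
  integrable over that product of half lines.
\<close>

lemma nn_integral_off_hyperplanes_finite:
  assumes "0 < \<epsilon>"
  shows "(\<integral>\<^sup>+u. ennreal (weight lam u) * ennreal (indicator (off_hyperplanes \<epsilon>) u * \<bar>body_diff u\<bar>) \<partial>lborel) < \<infinity>"
proof -
  obtain \<rho> where \<rho>: "\<rho> > 0" "\<And>u. norm u \<le> \<rho> \<Longrightarrow> body_diff u = 0" using body_diff_eq_0_near_zero by blast
  define c where "c = \<epsilon> * \<rho>"
  have c: "c > 0" using assms \<rho> by (simp add: c_def)
  define f where "f i t = ennreal (t powr (- lam i - 1)) * indicator {c..} t" for i t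
  have [measurable]: "f i \<in> borel_measurable borel" for i unfolding f_def[abs_def] by measurable
  have "ennreal (weight lam u) * ennreal (indicator (off_hyperplanes \<epsilon>) u * \<bar>body_diff u\<bar>) \<le>
      ennreal (2 ^ CARD('n)) * (\<Prod>i\<in>UNIV. f i \<bar>u $ i\<bar>)" for u
  proof (cases "u \<in> off_hyperplanes \<epsilon> \<and> body_diff u \<noteq> 0")
    case True
    hence "norm u > \<rho>" using \<rho>(2)[of u] by force
    hence "c < \<epsilon> * norm u" using assms by (simp add: c_def)
    moreover have "\<epsilon> * norm u < \<bar>u $ i\<bar>" for i using True by (simp add: off_hyperplanes_def)
    ultimately have "c \<le> \<bar>u $ i\<bar>" for i by (meson less_imp_le less_trans)
    hence "f i \<bar>u $ i\<bar> = ennreal (\<bar>u $ i\<bar> powr (- lam i - 1))" for i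
      by (simp add: f_def)
    hence "(\<Prod>i\<in>UNIV. f i \<bar>u $ i\<bar>) = ennreal (weight lam u)"
      by (simp add: weight_def prod_ennreal)
    thus ?thesis using abs_body_diff_le[of u] True
      by (simp add: mult.commute ennreal_mult'[symmetric] mult_left_mono)
  qed auto
  hence "(\<integral>\<^sup>+u. ennreal (weight lam u) * ennreal (indicator (off_hyperplanes \<epsilon>) u * \<bar>body_diff u\<bar>) \<partial>lborel) \<le>
      (\<integral>\<^sup>+u. ennreal (2 ^ CARD('n)) * (\<Prod>i\<in>UNIV. f i \<bar>u $ i\<bar>) \<partial>lborel)"
    by (intro nn_integral_mono) auto
  also have "\<dots> = ennreal (2 ^ CARD('n)) * (\<Prod>i\<in>UNIV. \<integral>\<^sup>+t. f i \<bar>t\<bar> \<partial>lborel)"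
    using nn_integral_lborel_vec_prod[of "\<lambda>i t. f i \<bar>t\<bar>"] by (subst nn_integral_cmult) auto
  also have "\<dots> < \<infinity>"
  proof -
    have "(\<integral>\<^sup>+t. f i \<bar>t\<bar> \<partial>lborel) = 2 * ennreal (c powr - lam i / lam i)" for i
    proof -
      have "(\<integral>\<^sup>+t. f i \<bar>t\<bar> \<partial>lborel) = 2 * (\<integral>\<^sup>+t. f i t * indicator {0..} t \<partial>lborel)"
        by (rule nn_integral_abs) auto
      also have "(\<integral>\<^sup>+t. f i t * indicator {0..} t \<partial>lborel) = (\<integral>\<^sup>+t. f i t \<partial>lborel)"
        using c by (intro nn_integral_cong) (auto simp: f_def indicator_def)
      also have "(\<integral>\<^sup>+t. f i t \<partial>lborel) = ennreal (c powr - lam i / lam i)"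
        unfolding f_def by (rule nn_integral_powr_atLeast) (use c lam_pos in auto)
      finally show ?thesis .
    qed
    thus ?thesis
      by (auto simp: ennreal_mult_less_top less_top[symmetric] ennreal_prod_eq_top ennreal_mult_eq_top_iff)
  qed
  finally show ?thesis .
qed

lemma integrable_off_hyperplanes:
  assumes "0 < \<epsilon>"
  shows "integrable lborel (\<lambda>u. weight lam u * (indicator (off_hyperplanes \<epsilon>) u * body_diff u))"
proof (rule integrableI_bounded)
  have "ennreal (norm (weight lam u * (indicator (off_hyperplanes \<epsilon>) u * body_diff u))) =
      ennreal (weight lam u) * ennreal (indicator (off_hyperplanes \<epsilon>) u * \<bar>body_diff u\<bar>)" for u
    by (simp add: abs_mult ennreal_mult'[symmetric])
  thus "(\<integral>\<^sup>+u. ennreal (norm (weight lam u * (indicator (off_hyperplanes \<epsilon>) u * body_diff u))) \<partial>lborel) < \<infinity>"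
    using nn_integral_off_hyperplanes_finite[OF assms] by simp
qed measurable

definition cone_integral :: "real \<Rightarrow> real" where
  "cone_integral \<epsilon> = (\<integral>u. weight lam u * (indicator (off_hyperplanes \<epsilon>) u * body_diff u) \<partial>lborel)"

text \<open>
  Fubini's theorem for the representation of \<open>char_fun\<close> by dilates of the body. For fixed \<open>r\<close> the
  substitution \<open>v = r powr (- 1 / \<alpha>) *\<^sub>R u\<close> preserves the cone, and the homogeneity of the weight
  produces the factor \<open>r powr (- L / \<alpha>)\<close>, whose integral against \<open>exp (- r)\<close> is the value of Gamma.
  The same computation with absolute values justifies the exchange.
\<close>

lemma
  assumes \<epsilon>: "0 < \<epsilon>"
  shows integrable_cone_char_fun:
      "integrable lborel (\<lambda>u. weight lam u * (indicator (off_hyperplanes \<epsilon>) u * all_coord_diff char_fun u))"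
    and integral_cone_char_fun:
      "(\<integral>u. weight lam u * (indicator (off_hyperplanes \<epsilon>) u * all_coord_diff char_fun u) \<partial>lborel) =
        Gamma (1 - L / \<alpha>) * cone_integral \<epsilon>"
proof -
  let ?C = "off_hyperplanes \<epsilon> :: (real ^ 'n) set"
  define s where "s r = r powr (- 1 / \<alpha>)" for r :: real
  have s_pos: "s r > 0" if "r > 0" for r using that by (simp add: s_def)
  have s_L: "s r powr L = r powr (1 - L / \<alpha> - 1)" if "r > 0" for r
    by (simp add: s_def powr_powr)
  have [measurable]: "s \<in> borel_measurable borel" unfolding s_def[abs_def] by measurable
  define h where "h = (\<lambda>(r, u). indicator {0<..} r * exp (- r) *
      (weight lam u * (indicator ?C u * body_diff (s r *\<^sub>R u))))"
  have [measurable]: "h \<in> borel_measurable (lborel \<Otimes>\<^sub>M lborel)"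
    unfolding h_def by measurable
  have C_scale: "indicator ?C u = (indicator ?C (s r *\<^sub>R u) :: real)" if "r > 0" for r u
    using off_hyperplanes_scaleR[OF s_pos[OF that], of u] by (simp add: indicator_def)
  have Gamma: "has_bochner_integral lborel (\<lambda>r. indicator {0<..} r * exp (- r) * s r powr L) (Gamma (1 - L / \<alpha>))"
  proof (rule has_bochner_integral_nn_integral)
    have "(\<integral>\<^sup>+r. ennreal (indicator {0<..} r * exp (- r) * s r powr L) \<partial>lborel) =
      (\<integral>\<^sup>+r. ennreal (r powr (1 - L / \<alpha> - 1)) * (ennreal (exp (- r)) * indicator {0..} r) \<partial>lborel)"
    proof (rule nn_integral_cong_AE)
      have "AE r in lborel. r \<noteq> (0::real)" by (rule AE_lborel_singleton)
      thus "AE r in lborel. ennreal (indicator {0<..} r * exp (- r) * s r powr L) =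
          ennreal (r powr (1 - L / \<alpha> - 1)) * (ennreal (exp (- r)) * indicator {0..} r)"
        by eventually_elim (auto simp: indicator_def s_L ennreal_mult'[symmetric] mult.commute)
    qed
    also have "\<dots> = ennreal (Gamma (1 - L / \<alpha>))"
      by (rule nn_integral_Gamma) (use sum_lam_less \<alpha> in auto)
    finally show "(\<integral>\<^sup>+r. ennreal (indicator {0<..} r * exp (- r) * s r powr L) \<partial>lborel) =
        ennreal (Gamma (1 - L / \<alpha>))" .
  qed (use Gamma_pos in auto)
  let ?B = "\<integral>\<^sup>+u. ennreal (weight lam u) * ennreal (indicator ?C u * \<bar>body_diff u\<bar>) \<partial>lborel"
  have int_h: "integrable (lborel \<Otimes>\<^sub>M lborel) h"
  proof (rule integrableI_bounded)
    have "(\<integral>\<^sup>+z. ennreal (norm (h z)) \<partial>(lborel \<Otimes>\<^sub>M lborel)) =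
        (\<integral>\<^sup>+r. \<integral>\<^sup>+u. ennreal (norm (h (r, u))) \<partial>lborel \<partial>lborel)"
      by (rule lborel.nn_integral_fst[symmetric]) measurable
    also have "\<dots> = (\<integral>\<^sup>+r. ennreal (indicator {0<..} r * exp (- r) * s r powr L) * ?B \<partial>lborel)"
    proof (intro nn_integral_cong)
      fix r :: real
      show "(\<integral>\<^sup>+u. ennreal (norm (h (r, u))) \<partial>lborel) =
          ennreal (indicator {0<..} r * exp (- r) * s r powr L) * ?B"
      proof (cases "r > 0")
        case True
        have "(\<integral>\<^sup>+u. ennreal (norm (h (r, u))) \<partial>lborel) =
          (\<integral>\<^sup>+u. ennreal (exp (- r)) * (ennreal (weight lam u) *
            ennreal (indicator ?C (s r *\<^sub>R u) * \<bar>body_diff (s r *\<^sub>R u)\<bar>)) \<partial>lborel)"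
          using True
          by (intro nn_integral_cong) (simp add: h_def C_scale[symmetric] abs_mult ennreal_mult'[symmetric])
        also have "\<dots> = ennreal (exp (- r)) * (ennreal (s r powr L) * ?B)"
          using nn_integral_weight_scaleR[OF _ s_pos[OF True],
              of "\<lambda>u. ennreal (indicator ?C u * \<bar>body_diff u\<bar>)" lam]
          by (subst nn_integral_cmult) auto
        finally show ?thesis using True by (simp add: ennreal_mult' mult.assoc)
      qed (simp add: h_def)
    qed
    also have "\<dots> = ennreal (Gamma (1 - L / \<alpha>)) * ?B"
      using has_bochner_integral_iff[THEN iffD1, OF Gamma]
      by (subst nn_integral_multc) (auto simp: nn_integral_eq_integral)
    also have "\<dots> < \<infinity>"
      using nn_integral_off_hyperplanes_finite[OF \<epsilon>] by (simp add: ennreal_mult_less_top)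
    finally show "(\<integral>\<^sup>+z. ennreal (norm (h z)) \<partial>(lborel \<Otimes>\<^sub>M lborel)) < \<infinity>" .
  qed measurable
  have inner_r: "(\<integral>r. h (r, u) \<partial>lborel) = weight lam u * (indicator ?C u * all_coord_diff char_fun u)" for u
  proof -
    have "(\<integral>r. h (r, u) \<partial>lborel) = (\<integral>r. (weight lam u * indicator ?C u) *
        (indicator {0<..} r * exp (- r) * body_diff (r powr (- 1 / \<alpha>) *\<^sub>R u)) \<partial>lborel)"
      by (intro Bochner_Integration.integral_cong) (auto simp: h_def s_def mult_ac)
    also have "\<dots> = weight lam u * indicator ?C u * all_coord_diff char_fun u"
      using has_bochner_integral_coord_diff_char_fun[of u] by (simp add: has_bochner_integral_iff)
    finally show ?thesis by (simp add: mult_ac)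
  qed
  have inner_u: "(\<integral>u. h (r, u) \<partial>lborel) = indicator {0<..} r * exp (- r) * s r powr L * cone_integral \<epsilon>" for r
  proof (cases "r > 0")
    case True
    have "(\<integral>u. h (r, u) \<partial>lborel) = (\<integral>u. exp (- r) * (weight lam u *
        (indicator ?C (s r *\<^sub>R u) * body_diff (s r *\<^sub>R u))) \<partial>lborel)"
      using True by (intro Bochner_Integration.integral_cong) (auto simp: h_def C_scale[symmetric])
    also have "\<dots> = exp (- r) * (s r powr L * cone_integral \<epsilon>)"
      using integral_weight_scaleR[OF _ s_pos[OF True], of "\<lambda>u. indicator ?C u * body_diff u" lam]
      by (simp add: cone_integral_def)
    finally show ?thesis using True by simp
  qed (simp add: h_def)
  show "integrable lborel (\<lambda>u. weight lam u * (indicator ?C u * all_coord_diff char_fun u))"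
    using lborel_pair.integrable_snd[where f = "\<lambda>r u. h (r, u)"] int_h by (simp add: inner_r)
  have "(\<integral>u. weight lam u * (indicator ?C u * all_coord_diff char_fun u) \<partial>lborel) =
      (\<integral>u. \<integral>r. h (r, u) \<partial>lborel \<partial>lborel)"
    by (simp add: inner_r)
  also have "\<dots> = (\<integral>r. \<integral>u. h (r, u) \<partial>lborel \<partial>lborel)"
    using lborel_pair.Fubini_integral[where f = "\<lambda>r u. h (r, u)"] int_h by simp
  also have "\<dots> = Gamma (1 - L / \<alpha>) * cone_integral \<epsilon>"
    using Gamma by (simp add: inner_u has_bochner_integral_iff)
  finally show "(\<integral>u. weight lam u * (indicator ?C u * all_coord_diff char_fun u) \<partial>lborel) =
      Gamma (1 - L / \<alpha>) * cone_integral \<epsilon>" .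
qed

text \<open>
  Weight, cone and Lebesgue measure are invariant under sign changes, so the integral of
  \<open>all_coord_diff char_fun\<close> equals its average over all of them.
\<close>

lemma integral_cone_cos_prod:
  assumes \<epsilon>: "0 < \<epsilon>"
  shows "(LINT u:off_hyperplanes \<epsilon>|lborel. weight lam u * cos_prod u) =
    (-1) ^ CARD('n) * Gamma (1 - L / \<alpha>) * cone_integral \<epsilon>"
proof -
  let ?C = "off_hyperplanes \<epsilon> :: (real ^ 'n) set"
  define k where "k u = weight lam u * (indicator ?C u * all_coord_diff char_fun u)" for u
  have [measurable]: "k \<in> borel_measurable borel" unfolding k_def[abs_def] by measurable
  have k: "integrable lborel k" "(\<integral>u. k u \<partial>lborel) = Gamma (1 - L / \<alpha>) * cone_integral \<epsilon>"
    using integrable_cone_char_fun[OF \<epsilon>] integral_cone_char_fun[OF \<epsilon>] by (simp_all add: k_def[abs_def])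
  have k_flip: "k (flip_signs S u) = weight lam u * (indicator ?C u * all_coord_diff char_fun (flip_signs S u))" for S u
    by (simp add: k_def indicator_def)
  have int_flip: "integrable lborel (\<lambda>u. k (flip_signs S u))" for S
    using integrable_distr[of "flip_signs S" "lborel :: (real ^ 'n) measure" borel k] k(1)
    by (simp add: lborel_distr_flip_signs)
  have "2 ^ CARD('n) * (\<integral>u. k u \<partial>lborel) = (\<Sum>S\<in>Pow (UNIV :: 'n set). \<integral>u. k (flip_signs S u) \<partial>lborel)"
    by (simp add: integral_lborel_flip_signs card_Pow)
  also have "\<dots> = (\<integral>u. (\<Sum>S\<in>Pow UNIV. k (flip_signs S u)) \<partial>lborel)"
    by (rule Bochner_Integration.integral_sum[symmetric]) (rule int_flip)
  also have "\<dots> = (\<integral>u. (-2) ^ CARD('n) * (indicator ?C u * (weight lam u * cos_prod u)) \<partial>lborel)"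
    unfolding k_flip sum_distrib_left[symmetric] sum_flip_signs_coord_diff_char_fun
    by (simp add: mult_ac)
  also have "\<dots> = (-2) ^ CARD('n) * (LINT u:?C|lborel. weight lam u * cos_prod u)"
    by (simp add: set_lebesgue_integral_def)
  finally have "2 ^ CARD('n) * (\<integral>u. k u \<partial>lborel) =
      2 ^ CARD('n) * ((-1) ^ CARD('n) * (LINT u:?C|lborel. weight lam u * cos_prod u))"
    by (simp add: mult.assoc[symmetric] power_mult_distrib[symmetric])
  hence "(\<integral>u. k u \<partial>lborel) = (-1) ^ CARD('n) * (LINT u:?C|lborel. weight lam u * cos_prod u)"
    by simp
  hence "(-1) ^ CARD('n) * (\<integral>u. k u \<partial>lborel) = (LINT u:?C|lborel. weight lam u * cos_prod u)"
    by (simp add: mult.assoc[symmetric] power_mult_distrib[symmetric])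
  thus ?thesis using k(2) by simp
qed

lemma moment_integrand_eq: "moment_integrand lam body u = weight lam u * body_diff u"
  by (simp add: moment_integrand_def weight_def)

text \<open>
  The function \<open>cos_prod\<close> times the weight is integrable over the whole space, so its integrals over
  the cones converge; on each cone they are a fixed multiple of those of the moment integrand.
\<close>

lemma has_pv_integral_moment_integrand:
  "has_pv_integral (moment_integrand lam body)
    ((-1) ^ CARD('n) * ((\<Prod>i\<in>UNIV. cos_kernel_const (lam i)) * moment) / Gamma (1 - L / \<alpha>))"
  unfolding has_pv_integral_def
proof (intro conjI allI impI)
  show "set_integrable lborel (off_hyperplanes \<epsilon>) (moment_integrand lam body)" if "0 < \<epsilon>" for \<epsilon>
    using integrable_off_hyperplanes[OF that]
    by (simp add: set_integrable_def moment_integrand_eq mult_ac)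
  have cone: "(LINT u:off_hyperplanes \<epsilon>|lborel. moment_integrand lam body u) =
      (-1) ^ CARD('n) * (LINT u:off_hyperplanes \<epsilon>|lborel. weight lam u * cos_prod u) / Gamma (1 - L / \<alpha>)"
    if "0 < \<epsilon>" for \<epsilon>
  proof -
    have "(LINT u:off_hyperplanes \<epsilon>|lborel. moment_integrand lam body u) = cone_integral \<epsilon>"
      by (simp add: set_lebesgue_integral_def cone_integral_def moment_integrand_eq mult_ac)
    thus ?thesis
      using Gamma_pos by (simp add: integral_cone_cos_prod[OF that] mult.assoc[symmetric] power_mult_distrib[symmetric])
  qed
  have "((\<lambda>\<epsilon>. LINT u:off_hyperplanes \<epsilon>|lborel. weight lam u * cos_prod u) \<longlongrightarrow>
      (\<Prod>i\<in>UNIV. cos_kernel_const (lam i)) * moment) (at_right 0)"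
    using has_pv_integral_lebesgue[of "\<lambda>u. weight lam u * cos_prod u"] has_bochner_integral_weight_cos_prod
    by (auto simp: has_pv_integral_def has_bochner_integral_iff)
  hence "((\<lambda>\<epsilon>. (-1) ^ CARD('n) * (LINT u:off_hyperplanes \<epsilon>|lborel. weight lam u * cos_prod u) / Gamma (1 - L / \<alpha>)) \<longlongrightarrow>
      (-1) ^ CARD('n) * ((\<Prod>i\<in>UNIV. cos_kernel_const (lam i)) * moment) / Gamma (1 - L / \<alpha>)) (at_right 0)"
    using Gamma_pos by (intro tendsto_intros) auto
  thus "((\<lambda>\<epsilon>. LINT u:off_hyperplanes \<epsilon>|lborel. moment_integrand lam body u) \<longlongrightarrow>
      (-1) ^ CARD('n) * ((\<Prod>i\<in>UNIV. cos_kernel_const (lam i)) * moment) / Gamma (1 - L / \<alpha>)) (at_right 0)"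
    by (rule Lim_transform_eventually)
      (auto simp: eventually_at_right_field cone[symmetric] intro!: exI[of _ 1])
qed

end

section \<open>Absolute integrability for total exponent below one\<close>

lemma nn_integral_powr_indicator_diff:
  fixes a b :: real
  assumes "0 < p" "0 \<le> a" "0 \<le> b"
  shows "(\<integral>\<^sup>+s. ennreal (s powr (p - 1)) * ennreal \<bar>indicator {a..} s - indicator {b..} s\<bar> \<partial>lborel) =
    ennreal (\<bar>a powr p - b powr p\<bar> / p)"
  using assms(2,3)
proof (induction a b rule: linorder_wlog)
  case (le a b)
  let ?I = "\<integral>\<^sup>+s. ennreal (s powr (p - 1)) * indicator {a..<b} s \<partial>lborel"
  have ab: "a powr p \<le> b powr p" using le assms(1) by (intro powr_mono2) auto
  have "ennreal (a powr p / p) + ?I =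
      (\<integral>\<^sup>+s. ennreal (s powr (p - 1)) * indicator {0..a} s + ennreal (s powr (p - 1)) * indicator {a..<b} s \<partial>lborel)"
    using nn_integral_powr_Icc[of "p - 1" a] le assms(1) by (subst nn_integral_add) auto
  also have "\<dots> = (\<integral>\<^sup>+s. ennreal (s powr (p - 1)) * indicator {0..b} s \<partial>lborel)"
  proof (rule nn_integral_cong_AE)
    have "AE s in lborel. s \<noteq> a" "AE s in lborel. s \<noteq> b" by (rule AE_lborel_singleton)+
    thus "AE s in lborel. ennreal (s powr (p - 1)) * indicator {0..a} s + ennreal (s powr (p - 1)) * indicator {a..<b} s =
        ennreal (s powr (p - 1)) * indicator {0..b} s"
      by eventually_elim (use le in \<open>auto simp: indicator_def\<close>)
  qed
  also have "\<dots> = ennreal (b powr p / p)"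
    using nn_integral_powr_Icc[of "p - 1" b] le assms(1) by simp
  also have "\<dots> = ennreal (a powr p / p) + ennreal ((b powr p - a powr p) / p)"
    using ab assms(1) by (subst ennreal_plus[symmetric]) (auto simp: diff_divide_distrib divide_right_mono)
  finally have "?I = ennreal ((b powr p - a powr p) / p)"
    by (simp add: ennreal_add_left_cancel)
  moreover have "ennreal (s powr (p - 1)) * ennreal \<bar>indicator {a..} s - indicator {b..} s\<bar> =
      ennreal (s powr (p - 1)) * indicator {a..<b} s" for s
    using le by (auto simp: indicator_def)
  ultimately show ?case using ab by simp
next
  case (sym a b)
  thus ?case by (simp add: abs_minus_commute)
qed

text \<open>
  The measure \<open>ds / s\<close> is invariant under dilations, so the value does not depend on \<open>x\<close>. It is
  used to insert the factor \<open>1\<close> in the form of an average over dilates.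
\<close>

lemma nn_integral_inverse_scale:
  fixes x :: real
  assumes "0 < x"
  shows "(\<integral>\<^sup>+s. ennreal (1 / s) * indicator {0<..} s * indicator {1..2} (s * x) \<partial>lborel) = ennreal (ln 2)"
proof -
  have "(\<integral>\<^sup>+s. ennreal (1 / s) * indicator {0<..} s * indicator {1..2} (s * x) \<partial>lborel) =
      (\<integral>\<^sup>+s. ennreal (1 / s) * indicator {1 / x..2 / x} s \<partial>lborel)"
  proof (intro nn_integral_cong)
    fix s
    have "0 < s" if "1 \<le> s * x" using that assms by (smt (verit) mult_nonpos_nonneg)
    thus "ennreal (1 / s) * indicator {0<..} s * indicator {1..2} (s * x) =
        ennreal (1 / s) * indicator {1 / x..2 / x} s"
      using assms by (auto simp: indicator_def field_simps)
  qed
  also have "\<dots> = ennreal (ln (2 / x) - ln (1 / x))"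
  proof (rule nn_integral_FTC_Icc)
    fix s assume "s \<in> {1 / x..2 / x}"
    hence "1 / x \<le> s" by simp
    moreover have "0 < 1 / x" using assms by simp
    ultimately have s: "0 < s" by linarith
    thus "(ln has_real_derivative 1 / s) (at s)"
      by (auto intro!: derivative_eq_intros)
    show "0 \<le> 1 / s" using s by simp
  qed (use assms in \<open>auto simp: field_simps\<close>)
  also have "ln (2 / x) - ln (1 / x) = ln 2" using assms by (simp add: ln_div)
  finally show ?thesis .
qed

text \<open>
  The power of the smallest coordinate is split as \<open>\<Prod>\<^sub>i \<bar>v\<^sub>k\<bar> powr e\<^sub>i\<close> with \<open>\<Sum>\<^sub>i e\<^sub>i = \<Sum>\<^sub>i lam\<^sub>i\<close>, and each
  factor is bounded by the same power of \<open>\<bar>v\<^sub>i\<bar>\<close>. The coordinate \<open>m\<close> is bounded away from zero and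
  requires no help, so its share \<open>lam m\<close> is distributed evenly: every other exponent \<open>- lam i - 1\<close>
  becomes \<open>\<delta> - 1\<close> with \<open>\<delta> = lam m / d > 0\<close>, which is integrable at zero.
\<close>

lemma weight_times_min_powr_le:
  fixes v :: "real ^ 'n"
  assumes lam: "\<And>i. 0 < lam i" and m: "1 \<le> \<bar>v $ m\<bar>" and k: "\<And>i. \<bar>v $ k\<bar> \<le> \<bar>v $ i\<bar>"
  shows "weight lam v * \<bar>v $ k\<bar> powr (\<Sum>i\<in>UNIV. lam i) \<le> (\<Prod>i\<in>UNIV. \<bar>v $ i\<bar> powr (lam m / CARD('n) - 1))"
proof (cases "v $ k = 0")
  case True
  thus ?thesis by (simp add: prod_nonneg)
next
  case False
  define \<delta> where "\<delta> = lam m / CARD('n)"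
  define e where "e i = (if i = m then \<delta> else lam i + \<delta>)" for i
  have \<delta>: "\<delta> > 0" using lam by (simp add: \<delta>_def)
  have e: "0 < e i" for i using \<delta> lam[of i] by (simp add: e_def)
  have "(\<Sum>i\<in>UNIV. e i) = (\<Sum>i\<in>UNIV. lam i + \<delta> - (if i = m then lam m else 0))"
    by (intro sum.cong) (auto simp: e_def)
  also have "\<dots> = (\<Sum>i\<in>UNIV. lam i)"
    by (simp add: sum_subtractf sum.distrib \<delta>_def)
  finally have sum_e: "(\<Sum>i\<in>UNIV. lam i) = (\<Sum>i\<in>UNIV. e i)" ..
  have "\<bar>v $ k\<bar> powr (\<Sum>i\<in>UNIV. lam i) = (\<Prod>i\<in>UNIV. \<bar>v $ k\<bar> powr e i)"
    using False by (simp add: sum_e powr_sum)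
  hence "weight lam v * \<bar>v $ k\<bar> powr (\<Sum>i\<in>UNIV. lam i) =
      (\<Prod>i\<in>UNIV. \<bar>v $ i\<bar> powr (- lam i - 1) * \<bar>v $ k\<bar> powr e i)"
    by (simp add: weight_def prod.distrib)
  also have "\<dots> \<le> (\<Prod>i\<in>UNIV. \<bar>v $ i\<bar> powr (\<delta> - 1))"
  proof (intro prod_mono conjI)
    fix i
    have "\<bar>v $ i\<bar> powr (- lam i - 1) * \<bar>v $ k\<bar> powr e i \<le> \<bar>v $ i\<bar> powr (- lam i - 1) * \<bar>v $ i\<bar> powr e i"
      using e[of i] k by (intro mult_left_mono powr_mono2) auto
    also have "\<dots> = \<bar>v $ i\<bar> powr (- lam i - 1 + e i)" by (simp add: powr_add)
    also have "\<dots> \<le> \<bar>v $ i\<bar> powr (\<delta> - 1)"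
    proof (cases "i = m")
      case True
      thus ?thesis using m lam[of m] by (intro powr_mono) (auto simp: e_def)
    qed (simp add: e_def)
    finally show "\<bar>v $ i\<bar> powr (- lam i - 1) * \<bar>v $ k\<bar> powr e i \<le> \<bar>v $ i\<bar> powr (\<delta> - 1)" .
  qed auto
  finally show ?thesis by (simp add: \<delta>_def)
qed

lemma ex_min_coord: "\<exists>k. \<forall>i. \<bar>x $ k\<bar> \<le> \<bar>x $ i\<bar>" for x :: "real ^ 'n"
proof -
  have "Min (range (\<lambda>i. \<bar>x $ i\<bar>)) \<in> range (\<lambda>i. \<bar>x $ i\<bar>)" by (intro Min_in) auto
  then obtain k where k: "Min (range (\<lambda>i. \<bar>x $ i\<bar>)) = \<bar>x $ k\<bar>" by (rule imageE)
  have "\<bar>x $ k\<bar> \<le> \<bar>x $ i\<bar>" for i unfolding k[symmetric] by (intro Min_le) auto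
  thus ?thesis by blast
qed

context stable_moment
begin

lemma indicator_body_inverse_scaleR:
  assumes "0 < s"
  shows "indicator body (inverse s *\<^sub>R v) = (indicator {N v..} s :: real)"
proof -
  have "N (inverse s *\<^sub>R v) \<le> 1 \<longleftrightarrow> N v \<le> s"
    using assms by (simp add: N_scaleR field_simps)
  thus ?thesis by (simp add: body_def indicator_def)
qed

text \<open>
  As a function of \<open>s\<close>, the indicator of the body at \<open>v / s\<close> is the indicator of \<open>s \<ge> N v\<close>. Setting
  the coordinate \<open>i\<close> to zero therefore changes the integral by the difference of two values of
  \<open>N powr L / L\<close>, which by subadditivity is at most \<open>N (v\<^sub>i e\<^sub>i) powr L / L\<close>.
\<close>

lemma nn_integral_scale_body_diff_le:
  assumes "L < 1"
  shows "\<exists>C\<ge>0. \<forall>v i. (\<integral>\<^sup>+s. ennreal (s powr (L - 1)) * (indicator {0<..} s * ennreal \<bar>body_diff (inverse s *\<^sub>R v)\<bar>) \<partial>lborel)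
    \<le> ennreal (C * \<bar>v $ i\<bar> powr L)"
proof (intro exI allI conjI)
  define C where "C = 2 ^ CARD('n) * (\<Sum>i\<in>UNIV. N (axis i 1) powr L) / L"
  show C: "0 \<le> C" using L_pos by (simp add: C_def sum_nonneg)
  fix v :: "real ^ 'n" and i :: 'n
  let ?P = "Pow (UNIV - {i})"
  let ?a = "\<lambda>S. N (zero_on S v)" and ?b = "\<lambda>S. N (zero_on (insert i S) v)"
  have "(\<integral>\<^sup>+s. ennreal (s powr (L - 1)) * (indicator {0<..} s * ennreal \<bar>body_diff (inverse s *\<^sub>R v)\<bar>) \<partial>lborel) \<le>
    (\<integral>\<^sup>+s. (\<Sum>S\<in>?P. ennreal (s powr (L - 1)) * ennreal \<bar>indicator {?a S..} s - indicator {?b S..} s\<bar>) \<partial>lborel)"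
  proof (intro nn_integral_mono)
    fix s :: real
    show "ennreal (s powr (L - 1)) * (indicator {0<..} s * ennreal \<bar>body_diff (inverse s *\<^sub>R v)\<bar>) \<le>
        (\<Sum>S\<in>?P. ennreal (s powr (L - 1)) * ennreal \<bar>indicator {?a S..} s - indicator {?b S..} s\<bar>)"
    proof (cases "s > 0")
      case True
      have "\<bar>body_diff (inverse s *\<^sub>R v)\<bar> \<le> (\<Sum>S\<in>?P. \<bar>indicator {?a S..} s - indicator {?b S..} s\<bar>)"
        using abs_all_coord_diff_le[of "indicator body" "inverse s *\<^sub>R v" i]
        by (simp only: zero_on_scaleR indicator_body_inverse_scaleR[OF True])
      hence "ennreal \<bar>body_diff (inverse s *\<^sub>R v)\<bar> \<le> (\<Sum>S\<in>?P. ennreal \<bar>indicator {?a S..} s - indicator {?b S..} s\<bar>)"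
        by (subst sum_ennreal) (auto intro: ennreal_leI)
      thus ?thesis using True by (simp add: sum_distrib_left[symmetric] mult_left_mono)
    qed simp
  qed
  also have "\<dots> = (\<Sum>S\<in>?P. ennreal (\<bar>?a S powr L - ?b S powr L\<bar> / L))"
    using L_pos by (subst nn_integral_sum) (auto simp: nn_integral_powr_indicator_diff)
  also have "\<dots> \<le> (\<Sum>S\<in>?P. ennreal (\<bar>v $ i\<bar> powr L * N (axis i 1) powr L / L))"
  proof (intro sum_mono ennreal_leI divide_right_mono)
    fix S assume "S \<in> ?P"
    hence "zero_on S v - zero_on (insert i S) v = (v $ i) *\<^sub>R axis i 1"
      by (auto simp: vec_eq_iff zero_on_def axis_def)
    hence "\<bar>?a S powr L - ?b S powr L\<bar> \<le> N ((v $ i) *\<^sub>R axis i 1) powr L"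
      using abs_N_powr_diff_le[of L "zero_on S v" "zero_on (insert i S) v"] L_pos sum_lam_less assms by simp
    thus "\<bar>?a S powr L - ?b S powr L\<bar> \<le> \<bar>v $ i\<bar> powr L * N (axis i 1) powr L"
      by (simp add: N_scaleR powr_mult)
  qed (use L_pos in simp)
  also have "\<dots> \<le> ennreal (C * \<bar>v $ i\<bar> powr L)"
  proof (subst sum_ennreal, simp add: L_pos less_imp_le, rule ennreal_leI)
    have "real (card ?P) * N (axis i 1) powr L \<le> 2 ^ CARD('n) * (\<Sum>i\<in>UNIV. N (axis i 1) powr L)"
    proof (intro mult_mono)
      have "card ?P \<le> card (Pow (UNIV :: 'n set))" by (intro card_mono) auto
      also have "\<dots> = 2 ^ CARD('n)" by (rule card_Pow) simp
      finally have "real (card ?P) \<le> real (2 ^ CARD('n))" by (simp only: of_nat_le_iff)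
      thus "real (card ?P) \<le> 2 ^ CARD('n)" by simp
      show "N (axis i 1) powr L \<le> (\<Sum>i\<in>UNIV. N (axis i 1) powr L)"
        by (rule member_le_sum) auto
    qed auto
    hence "\<bar>v $ i\<bar> powr L / L * (real (card ?P) * N (axis i 1) powr L) \<le> \<bar>v $ i\<bar> powr L / L * (2 ^ CARD('n) * (\<Sum>i\<in>UNIV. N (axis i 1) powr L))"
      using L_pos by (intro mult_left_mono) auto
    thus "(\<Sum>S\<in>?P. \<bar>v $ i\<bar> powr L * N (axis i 1) powr L / L) \<le> C * \<bar>v $ i\<bar> powr L"
      by (simp add: C_def mult_ac)
  qed
  finally show "(\<integral>\<^sup>+s. ennreal (s powr (L - 1)) * (indicator {0<..} s * ennreal \<bar>body_diff (inverse s *\<^sub>R v)\<bar>) \<partial>lborel)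
      \<le> ennreal (C * \<bar>v $ i\<bar> powr L)" .
qed

definition max_cone :: "'n \<Rightarrow> (real ^ 'n) set" where
  "max_cone m = {u. \<forall>j. \<bar>u $ j\<bar> \<le> \<bar>u $ m\<bar>}"

lemma measurable_max_cone [measurable]: "max_cone m \<in> sets borel"
  unfolding max_cone_def by measurable

text \<open>
  Averaging over dilates restricts the coordinate of largest modulus to \<open>{1..2}\<close> and, after a
  substitution, replaces \<open>body_diff\<close> by its integral over dilates, which is bounded by the smallest
  coordinate.
\<close>

lemma nn_integral_max_cone_finite:
  assumes "L < 1"
  shows "(\<integral>\<^sup>+u. ennreal (weight lam u) * (indicator (max_cone m) u * ennreal \<bar>body_diff u\<bar>) \<partial>lborel) < \<infinity>"
    (is "?Q < \<infinity>")
proof -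
  obtain C where C: "C \<ge> 0" "\<And>v i. (\<integral>\<^sup>+s. ennreal (s powr (L - 1)) *
      (indicator {0<..} s * ennreal \<bar>body_diff (inverse s *\<^sub>R v)\<bar>) \<partial>lborel) \<le> ennreal (C * \<bar>v $ i\<bar> powr L)"
    using nn_integral_scale_body_diff_le[OF assms] by blast
  define \<delta> where "\<delta> = lam m / CARD('n)"
  have \<delta>: "\<delta> > 0" using lam_pos by (simp add: \<delta>_def)
  define f where "f t = ennreal (t powr (\<delta> - 1)) * indicator {0..2} t" for t :: real
  have [measurable]: "f \<in> borel_measurable borel" unfolding f_def[abs_def] by measurable
  let ?I = "\<lambda>t. indicator {1..2::real} t :: ennreal"
  let ?A = "\<lambda>u. indicator (max_cone m) u :: ennreal"
  let ?D = "\<lambda>u. ennreal \<bar>body_diff u\<bar>"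
  let ?J = "\<lambda>s::real. indicator {0<..} s :: ennreal"
  have max_cone_scaleR: "?A (s *\<^sub>R u) = ?A u" if "s > 0" for s u
    using that by (simp add: max_cone_def indicator_def abs_mult)
  \<comment> \<open>In the cone the coordinate \<open>m\<close> vanishes only at the origin, where averaging over dilates is impossible.\<close>
  have zero: "body_diff u = 0" if "u \<in> max_cone m" "u $ m = 0" for u
  proof -
    have "u = 0" using that by (simp add: max_cone_def vec_eq_iff)
    thus ?thesis using body_diff_eq_0_near_zero by auto
  qed
  have "ennreal (ln 2) * ?Q =
    (\<integral>\<^sup>+u. \<integral>\<^sup>+s. ennreal (weight lam u) * (?A u * ?D u) * (ennreal (1 / s) * ?J s * ?I (s * \<bar>u $ m\<bar>)) \<partial>lborel \<partial>lborel)"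
  proof (subst nn_integral_cmult[symmetric], measurable, intro nn_integral_cong)
    fix u
    show "ennreal (ln 2) * (ennreal (weight lam u) * (?A u * ?D u)) =
      (\<integral>\<^sup>+s. ennreal (weight lam u) * (?A u * ?D u) * (ennreal (1 / s) * ?J s * ?I (s * \<bar>u $ m\<bar>)) \<partial>lborel)"
    proof (cases "u \<in> max_cone m \<and> u $ m = 0")
      case True
      thus ?thesis using zero by simp
    next
      case False
      show ?thesis
      proof (cases "u \<in> max_cone m")
        case True
        hence "0 < \<bar>u $ m\<bar>" using False by simp
        thus ?thesis
          by (subst nn_integral_cmult, measurable, subst nn_integral_inverse_scale) (simp_all add: mult.commute)
      qed simp
    qed
  qed
  also have "\<dots> = (\<integral>\<^sup>+s. \<integral>\<^sup>+u. ennreal (weight lam u) * (?A u * ?D u) * (ennreal (1 / s) * ?J s * ?I (s * \<bar>u $ m\<bar>)) \<partial>lborel \<partial>lborel)"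
    by (rule lborel_pair.Fubini') measurable
  \<comment> \<open>For fixed \<open>s\<close>, substitute \<open>v = s *\<^sub>R u\<close>; the factor \<open>s powr L\<close> is due to the weight.\<close>
  also have "\<dots> = (\<integral>\<^sup>+s. \<integral>\<^sup>+v. ennreal (weight lam v) * (?A v * ?I \<bar>v $ m\<bar>) *
      (ennreal (s powr (L - 1)) * (?J s * ?D (inverse s *\<^sub>R v))) \<partial>lborel \<partial>lborel)"
  proof (rule nn_integral_cong)
    fix s :: real
    show "(\<integral>\<^sup>+u. ennreal (weight lam u) * (?A u * ?D u) * (ennreal (1 / s) * ?J s * ?I (s * \<bar>u $ m\<bar>)) \<partial>lborel) =
      (\<integral>\<^sup>+v. ennreal (weight lam v) * (?A v * ?I \<bar>v $ m\<bar>) *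
        (ennreal (s powr (L - 1)) * (?J s * ?D (inverse s *\<^sub>R v))) \<partial>lborel)"
    proof (cases "s > 0")
      case True
      define g where "g v = ?A v * ?I \<bar>v $ m\<bar> * ?D (inverse s *\<^sub>R v)" for v
      have [measurable]: "g \<in> borel_measurable borel" unfolding g_def[abs_def] by measurable
      have "(\<integral>\<^sup>+u. ennreal (weight lam u) * (?A u * ?D u) * (ennreal (1 / s) * ?J s * ?I (s * \<bar>u $ m\<bar>)) \<partial>lborel) =
        (\<integral>\<^sup>+u. ennreal (1 / s) * (ennreal (weight lam u) * g (s *\<^sub>R u)) \<partial>lborel)"
        using True by (intro nn_integral_cong) (simp add: g_def max_cone_scaleR abs_mult mult_ac)
      also have "\<dots> = ennreal (1 / s) * (ennreal (s powr L) * (\<integral>\<^sup>+v. ennreal (weight lam v) * g v \<partial>lborel))"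
        by (subst nn_integral_cmult, measurable, subst nn_integral_weight_scaleR[OF _ True]) auto
      also have "\<dots> = ennreal (s powr (L - 1)) * (\<integral>\<^sup>+v. ennreal (weight lam v) * g v \<partial>lborel)"
        using True by (simp add: mult.assoc[symmetric] ennreal_mult'[symmetric] powr_diff)
      also have "\<dots> = (\<integral>\<^sup>+v. ennreal (s powr (L - 1)) * (ennreal (weight lam v) * g v) \<partial>lborel)"
        by (rule nn_integral_cmult[symmetric]) measurable
      finally show ?thesis using True by (simp add: g_def mult_ac)
    qed simp
  qed
  also have "\<dots> = (\<integral>\<^sup>+v. \<integral>\<^sup>+s. ennreal (weight lam v) * (?A v * ?I \<bar>v $ m\<bar>) *
      (ennreal (s powr (L - 1)) * (?J s * ?D (inverse s *\<^sub>R v))) \<partial>lborel \<partial>lborel)"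
    by (rule lborel_pair.Fubini'[symmetric]) measurable
  also have "\<dots> \<le> (\<integral>\<^sup>+v. ennreal C * (\<Prod>i\<in>UNIV. f \<bar>v $ i\<bar>) \<partial>(lborel :: (real ^ 'n) measure))"
  proof (rule nn_integral_mono)
    fix v :: "real ^ 'n"
    obtain k where k: "\<And>i. \<bar>v $ k\<bar> \<le> \<bar>v $ i\<bar>" using ex_min_coord[of v] by blast
    have "(\<integral>\<^sup>+s. ennreal (weight lam v) * (?A v * ?I \<bar>v $ m\<bar>) *
        (ennreal (s powr (L - 1)) * (?J s * ?D (inverse s *\<^sub>R v))) \<partial>lborel) =
      ennreal (weight lam v) * (?A v * ?I \<bar>v $ m\<bar>) *
        (\<integral>\<^sup>+s. ennreal (s powr (L - 1)) * (?J s * ?D (inverse s *\<^sub>R v)) \<partial>lborel)"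
      by (rule nn_integral_cmult) measurable
    also have "\<dots> \<le> ennreal (weight lam v) * (?A v * ?I \<bar>v $ m\<bar>) * ennreal (C * \<bar>v $ k\<bar> powr L)"
      by (intro mult_left_mono C) auto
    also have "\<dots> \<le> ennreal C * (\<Prod>i\<in>UNIV. f \<bar>v $ i\<bar>)"
    proof (cases "v \<in> max_cone m \<and> \<bar>v $ m\<bar> \<in> {1..2}")
      case True
      have "\<bar>v $ i\<bar> \<le> 2" for i using True order_trans[of "\<bar>v $ i\<bar>" "\<bar>v $ m\<bar>" 2] by (simp add: max_cone_def)
      hence "(\<Prod>i\<in>UNIV. f \<bar>v $ i\<bar>) = ennreal (\<Prod>i\<in>UNIV. \<bar>v $ i\<bar> powr (\<delta> - 1))"
        by (simp add: f_def prod_ennreal)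
      moreover have "weight lam v * \<bar>v $ k\<bar> powr L \<le> (\<Prod>i\<in>UNIV. \<bar>v $ i\<bar> powr (\<delta> - 1))"
        unfolding \<delta>_def using True by (intro weight_times_min_powr_le lam_pos k) auto
      hence "C * (weight lam v * \<bar>v $ k\<bar> powr L) \<le> C * (\<Prod>i\<in>UNIV. \<bar>v $ i\<bar> powr (\<delta> - 1))"
        using C(1) by (rule mult_left_mono)
      ultimately show ?thesis using True C(1)
        by (simp add: ennreal_mult'[symmetric] mult_ac ennreal_leI)
    qed (auto simp: indicator_def)
    finally show "(\<integral>\<^sup>+s. ennreal (weight lam v) * (?A v * ?I \<bar>v $ m\<bar>) *
        (ennreal (s powr (L - 1)) * (?J s * ?D (inverse s *\<^sub>R v))) \<partial>lborel) \<le>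
      ennreal C * (\<Prod>i\<in>UNIV. f \<bar>v $ i\<bar>)" .
  qed
  also have "\<dots> = ennreal C * (\<Prod>i\<in>(UNIV :: 'n set). \<integral>\<^sup>+t. f \<bar>t\<bar> \<partial>lborel)"
    by (subst nn_integral_cmult, measurable, subst nn_integral_lborel_vec_prod[where f = "\<lambda>_ t. f \<bar>t\<bar>"]) auto
  also have "\<dots> < \<infinity>"
  proof -
    have "(\<integral>\<^sup>+t. f \<bar>t\<bar> \<partial>lborel) = 2 * (\<integral>\<^sup>+t. f t * indicator {0..} t \<partial>lborel)"
      by (rule nn_integral_abs) measurable
    also have "(\<integral>\<^sup>+t. f t * indicator {0..} t \<partial>lborel) = (\<integral>\<^sup>+t. ennreal (t powr (\<delta> - 1)) * indicator {0..2} t \<partial>lborel)"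
      by (intro nn_integral_cong) (auto simp: f_def indicator_def)
    also have "\<dots> = ennreal (2 powr (\<delta> - 1 + 1) / (\<delta> - 1 + 1))"
      by (rule nn_integral_powr_Icc) (use \<delta> in auto)
    finally have "(\<integral>\<^sup>+t. f \<bar>t\<bar> \<partial>lborel) < \<infinity>" by (simp add: ennreal_mult_less_top)
    thus ?thesis by (auto simp: ennreal_mult_less_top power_less_top_ennreal)
  qed
  finally show ?thesis
    by (auto simp: ennreal_mult_less_top)
qed

lemma integrable_moment_integrand:
  assumes "L < 1"
  shows "integrable lborel (moment_integrand lam body)"
proof (rule integrableI_bounded)
  have "(\<integral>\<^sup>+u. ennreal (norm (moment_integrand lam body u)) \<partial>lborel) \<le>
    (\<integral>\<^sup>+u. (\<Sum>m\<in>UNIV. ennreal (weight lam u) * (indicator (max_cone m) u * ennreal \<bar>body_diff u\<bar>)) \<partial>lborel)"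
  proof (intro nn_integral_mono)
    fix u :: "real ^ 'n"
    obtain m where m: "u \<in> max_cone m" using ex_max_coord[of u] by (auto simp: max_cone_def)
    have "ennreal (norm (moment_integrand lam body u)) =
        ennreal (weight lam u) * (indicator (max_cone m) u * ennreal \<bar>body_diff u\<bar>)"
      using m by (simp add: moment_integrand_eq abs_mult ennreal_mult')
    also have "\<dots> \<le> (\<Sum>m\<in>UNIV. ennreal (weight lam u) * (indicator (max_cone m) u * ennreal \<bar>body_diff u\<bar>))"
      by (rule member_le_sum) auto
    finally show "ennreal (norm (moment_integrand lam body u)) \<le> \<dots>" .
  qed
  also have "\<dots> < \<infinity>"
    using nn_integral_max_cone_finite[OF assms]
    by (subst nn_integral_sum) auto
  finally show "(\<integral>\<^sup>+u. ennreal (norm (moment_integrand lam body u)) \<partial>lborel) < \<infinity>" .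
qed (simp add: moment_integrand_eq[abs_def])

end

section \<open>The moment formula\<close>

lemma stable_gauge_scaleR:
  assumes "0 < \<alpha>"
  shows "stable_gauge \<alpha> \<sigma> (c *\<^sub>R u) = \<bar>c\<bar> * stable_gauge \<alpha> \<sigma> u"
proof -
  have "(LINT z|\<sigma>. \<bar>(c *\<^sub>R u) \<bullet> z\<bar> powr \<alpha>) = \<bar>c\<bar> powr \<alpha> * (LINT z|\<sigma>. \<bar>u \<bullet> z\<bar> powr \<alpha>)"
    by (simp add: abs_mult powr_mult)
  moreover have "0 \<le> (LINT z|\<sigma>. \<bar>u \<bullet> z\<bar> powr \<alpha>)"
    by (intro Bochner_Integration.integral_nonneg) auto
  ultimately show ?thesis
    using assms by (simp add: stable_gauge_def powr_mult powr_powr)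
qed

lemma stable_gauge_nonneg: "0 \<le> stable_gauge \<alpha> \<sigma> u"
  by (simp add: stable_gauge_def)

lemma prod_cos_kernel_const:
  fixes lam :: "'n::finite \<Rightarrow> real"
  assumes lam: "\<And>i. 0 < lam i" "\<And>i. lam i < 2"
  shows "2 powr ((\<Sum>i\<in>UNIV. lam i) - real CARD('n)) / pi powr (real CARD('n) / 2) *
      (\<Prod>i\<in>UNIV. lam i * Gamma ((lam i + 1) / 2) / Gamma (1 - lam i / 2)) *
      (\<Prod>i\<in>UNIV. cos_kernel_const (lam i)) = 1"
proof -
  have "(2::real) powr ((\<Sum>i\<in>UNIV. lam i) - real CARD('n)) = 2 powr (\<Sum>i\<in>UNIV. lam i - 1)"
    by (simp add: sum_subtractf)
  also have "\<dots> = (\<Prod>i\<in>UNIV. 2 powr (lam i - 1))"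
    by (rule powr_sum) auto
  finally have two: "(2::real) powr ((\<Sum>i\<in>UNIV. lam i) - real CARD('n)) = (\<Prod>i\<in>UNIV. 2 powr (lam i - 1))" .
  have "pi powr (real CARD('n) / 2) = (pi powr (1 / 2)) powr real CARD('n)"
    by (subst powr_powr) simp
  also have "\<dots> = (\<Prod>i\<in>(UNIV::'n set). sqrt pi)"
    by (simp add: powr_half_sqrt powr_realpow)
  finally have pi: "pi powr (real CARD('n) / 2) = (\<Prod>i\<in>(UNIV::'n set). sqrt pi)" .
  show ?thesis
    unfolding two pi prod_dividef[symmetric] prod.distrib[symmetric]
  proof (intro prod.neutral ballI)
    fix i
    define G H where "G = Gamma ((lam i + 1) / 2)" and "H = Gamma (1 - lam i / 2)"
    have "0 < G" "0 < H"
      unfolding G_def H_def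
      using lam(1)[of i] lam(2)[of i] by (auto intro!: Gamma_real_pos divide_pos_pos add_pos_pos)
    moreover have "2 powr (lam i - 1) * 2 powr (1 - lam i) = (1::real)"
      by (simp add: powr_add[symmetric])
    moreover have "a / p * (l * G / H) * (b * p * H / (l * G)) = a * b"
      if "p \<noteq> 0" "l \<noteq> 0" "G \<noteq> 0" "H \<noteq> 0" for a b p l :: real
      using that by simp
    ultimately show "2 powr (lam i - 1) / sqrt pi * (lam i * Gamma ((lam i + 1) / 2) / Gamma (1 - lam i / 2)) *
        cos_kernel_const (lam i) = 1"
      using lam(1)[of i] by (simp add: cos_kernel_const_def G_def[symmetric] H_def[symmetric])
  qed
qed

theorem theorem6p10:
  fixes M :: "'a measure"
    and \<alpha> :: real
    and \<xi> :: "'a \<Rightarrow> real ^ 'n"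
    and F :: "(real ^ 'n) set"
    and lam :: "'n \<Rightarrow> real"
  assumes "prob_space M"
    and "0 < \<alpha>" and "\<alpha> \<le> 2"
    and "symmetric_stable M \<alpha> \<xi>"
    and "associated_star_body M \<alpha> \<xi> F"
    and "\<And>i. 0 < lam i"
    and "(\<Sum>i\<in>UNIV. lam i) < \<alpha>"
  shows "let L = (\<Sum>i\<in>UNIV. lam i);
             d = CARD('n);
             moment = (LINT \<omega>|M. (\<Prod>i\<in>UNIV. \<bar>\<xi> \<omega> $ i\<bar> powr lam i));
             c = 2 powr (L - real d) * ((-1) ^ d / pi powr (real d / 2)) * Gamma (1 - L / \<alpha>) *
                 (\<Prod>i\<in>UNIV. lam i * Gamma ((lam i + 1) / 2) / Gamma (1 - lam i / 2))
         in integrable M (\<lambda>\<omega>. \<Prod>i\<in>UNIV. \<bar>\<xi> \<omega> $ i\<bar> powr lam i) \<and>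
            pv_integrable (moment_integrand lam F) \<and>
            moment = c * pv_integral (moment_integrand lam F) \<and>
            (integrable lborel (moment_integrand lam F) \<longrightarrow>
               moment = c * (LINT u|lborel. moment_integrand lam F u)) \<and>
            (L < 1 \<longrightarrow> integrable lborel (moment_integrand lam F))"
proof -
  interpret prob_space M by fact
  obtain \<sigma> where \<sigma>: "spectral_measure M \<alpha> \<xi> \<sigma>" and F: "F = {u. stable_gauge \<alpha> \<sigma> u \<le> 1}"
    using assms(5) by (auto simp: associated_star_body_def)
  have [measurable]: "\<xi> \<in> borel_measurable M"
    using assms(4) by (simp add: symmetric_stable_def)
  interpret stable_moment M \<xi> \<alpha> "stable_gauge \<alpha> \<sigma>" lam
  proof unfold_locales
    fix u :: "real ^ 'n"
    have int: "integrable M (\<lambda>\<omega>. exp (\<i> * complex_of_real (\<xi> \<omega> \<bullet> u)))"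
      by (intro integrable_const_bound[where B = 1]) auto
    have "expectation (\<lambda>\<omega>. cos (\<xi> \<omega> \<bullet> u)) = Re (LINT \<omega>|M. exp (\<i> * complex_of_real (\<xi> \<omega> \<bullet> u)))"
      by (subst integral_Re[OF int, symmetric]) (simp add: Re_exp)
    also have "\<dots> = exp (- (stable_gauge \<alpha> \<sigma> u powr \<alpha>))"
      using \<sigma> unfolding spectral_measure_def by (metis Re_complex_of_real)
    finally show "expectation (\<lambda>\<omega>. cos (\<xi> \<omega> \<bullet> u)) = exp (- (stable_gauge \<alpha> \<sigma> u powr \<alpha>))" .
  qed (use assms in \<open>auto simp: stable_gauge_scaleR stable_gauge_nonneg\<close>)
  have body: "body = F" by (simp add: F body_def)
  define c where "c = 2 powr (L - real CARD('n)) * ((-1) ^ CARD('n) / pi powr (real CARD('n) / 2)) * Gamma (1 - L / \<alpha>) *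
      (\<Prod>i\<in>UNIV. lam i * Gamma ((lam i + 1) / 2) / Gamma (1 - lam i / 2))"
  have pv: "has_pv_integral (moment_integrand lam F)
      ((-1) ^ CARD('n) * ((\<Prod>i\<in>UNIV. cos_kernel_const (lam i)) * moment) / Gamma (1 - L / \<alpha>))"
    using has_pv_integral_moment_integrand by (simp add: body)
  have "c * ((-1) ^ CARD('n) * ((\<Prod>i\<in>UNIV. cos_kernel_const (lam i)) * moment) / Gamma (1 - L / \<alpha>)) =
      ((-1) ^ CARD('n) * (-1) ^ CARD('n)) *
      (2 powr (L - real CARD('n)) / pi powr (real CARD('n) / 2) *
      (\<Prod>i\<in>UNIV. lam i * Gamma ((lam i + 1) / 2) / Gamma (1 - lam i / 2)) *
      (\<Prod>i\<in>UNIV. cos_kernel_const (lam i))) * moment"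
    using Gamma_pos by (simp add: c_def)
  also have "\<dots> = moment"
    unfolding prod_cos_kernel_const[of lam, OF lam_pos lam_less_2]
    by (simp add: power_mult_distrib[symmetric])
  finally have eq: "moment = c * pv_integral (moment_integrand lam F)"
    by (simp add: pv_integral_eqI[OF pv])
  have "integrable lborel (moment_integrand lam F)" if "L < 1"
    using integrable_moment_integrand[OF that] by (simp add: body)
  moreover have "pv_integrable (moment_integrand lam F)"
    using pv by (auto simp: pv_integrable_def)
  moreover have "moment = c * (LINT u|lborel. moment_integrand lam F u)"
    if "integrable lborel (moment_integrand lam F)"
    using eq pv_integral_eq_lebesgue[OF that] by simp
  ultimately show ?thesis
    unfolding Let_def c_def[symmetric] moment_def[symmetric]
    using integrable_moment eq by blast
qed

end
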